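(* Let $\mathcal{W}=\bigcup_{n=1}^N\mathcal{W}_n$ with $\mathcal{W}_n=\{\omega:|\omega-\overline{\omega}_n|\le W_n/2\}$ pairwise disjoint, and let $\alpha_0\ge 0$. Let $Q(z,\omega)$, with $Q(z,\cdot)\in L^2(\mathbb{R})$, be the Fourier transform of a bounded signal $q(z,t)$ propagating according to $$\frac{\partial}{\partial z}Q(z,\omega)=\left(-\frac{\alpha(\omega)}{2}+j\frac{\beta_2}{2}\omega^2\right)Q(z,\omega)+j\frac{\gamma}{4\pi^2}\int_{-\infty}^{\infty}\int_{-\infty}^{\infty}Q(z,\omega_1)Q^*(z,\omega_2)Q(z,\omega-\omega_1+\omega_2)\,d\omega_2\,d\omega_1$$ with the brick-walls attenuation profile $\alpha(\omega)=\alpha_0$ for $\omega\in\mathcal{W}$ and $\alpha(\omega)=\infty$ otherwise. Then the signal has no energy outside $\mathcal{W}$ for $z>0$: $$E_{\overline{\mathcal{W}}}(z)=0,\quad z>0,$$ where $\overline{\mathcal{W}}=\mathbb{R}\setminus\mathcal{W}$, and the signal energy satisfies $$E(z)=E_{\mathcal{W}}(0)e^{-\alpha_0 z}\quad (z>0).$$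
   Context: $z$ is distance, $\omega$ angular frequency, $t$ time; $Q(z,\omega)=\int q(z,t)e^{-j\omega t}dt$; $\beta_2,\gamma$ are real constants; "bounded" means $|q(z,t)|\le q_{\max}$ for some constant. For a set $\mathcal{S}\subseteq\mathbb{R}$, $E_{\mathcal{S}}(z)=\frac{1}{2\pi}\int_{\mathcal{S}}|Q(z,\omega)|^2d\omega$, and $E(z)=E_{\mathbb{R}}(z)$. The propagation with infinite attenuation outside $\mathcal{W}$ is understood as the limit $\alpha_1\to\infty$ of propagation with the finite profile $\alpha(\omega)=\alpha_0$ on $\mathcal{W}$ and $\alpha(\omega)=\alpha_1$ off $\mathcal{W}$. *)

theory Defs
  imports "HOL-Analysis.Analysis"
begin

definition is_L2 :: "(real \<Rightarrow> complex) \<Rightarrow> bool" where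
  "is_L2 f \<longleftrightarrow> f \<in> borel_measurable lborel \<and> integrable lborel (\<lambda>x. (cmod (f x))^2)"

definition FT_L1 :: "(real \<Rightarrow> complex) \<Rightarrow> real \<Rightarrow> complex" where
  "FT_L1 \<phi> \<omega> = (LINT t|lborel. \<phi> t * exp (- \<i> * complex_of_real (\<omega> * t)))"

text \<open>Q is the (L2 / Plancherel) Fourier transform of q, characterised by Parseval's
  identity against all test functions in L1 \<inter> L2 (for which the transform is the
  Lebesgue integral). For q in L1 \<inter> L2 this agrees a.e. with the integral definition.\<close>
definition fourier_L2 :: "(real \<Rightarrow> complex) \<Rightarrow> (real \<Rightarrow> complex) \<Rightarrow> bool" where
  "fourier_L2 q Q \<longleftrightarrow> is_L2 q \<and> is_L2 Q \<and>
     (\<forall>\<phi>. integrable lborel \<phi> \<and> is_L2 \<phi> \<longrightarrow>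
        (LINT \<omega>|lborel. Q \<omega> * cnj (FT_L1 \<phi> \<omega>))
          = complex_of_real (2 * pi) * (LINT t|lborel. q t * cnj (\<phi> t)))"

definition energy_on :: "(real \<Rightarrow> complex) \<Rightarrow> real set \<Rightarrow> real" where
  "energy_on Q S = (LINT \<omega>:S|lborel. (cmod (Q \<omega>))^2) / (2 * pi)"

definition nl_term :: "(real \<Rightarrow> complex) \<Rightarrow> real \<Rightarrow> complex" where
  "nl_term Q \<omega> = (LINT \<omega>1|lborel. (LINT \<omega>2|lborel.
                     Q \<omega>1 * cnj (Q \<omega>2) * Q (\<omega> - \<omega>1 + \<omega>2)))"

definition propagates ::
  "(real \<Rightarrow> real) \<Rightarrow> real \<Rightarrow> real \<Rightarrow> (real \<Rightarrow> real \<Rightarrow> complex) \<Rightarrow> bool" where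
  "propagates \<alpha> \<beta>2 \<gamma> Q \<longleftrightarrow>
     (\<forall>z\<ge>0. \<forall>\<omega>. ((\<lambda>s. Q s \<omega>) has_vector_derivative
        ((- complex_of_real (\<alpha> \<omega>) / 2 + \<i> * complex_of_real (\<beta>2 / 2 * \<omega>^2)) * Q z \<omega>
         + \<i> * complex_of_real (\<gamma> / (4 * pi^2)) * nl_term (Q z) \<omega>)) (at z within {0..}))"

definition band :: "real \<Rightarrow> real \<Rightarrow> real set" where
  "band c w = {\<omega>. \<bar>\<omega> - c\<bar> \<le> w / 2}"

definition bands :: "nat \<Rightarrow> (nat \<Rightarrow> real) \<Rightarrow> (nat \<Rightarrow> real) \<Rightarrow> real set" where
  "bands N c w = (\<Union>n\<in>{1..N}. band (c n) (w n))"

definition brickwall :: "real \<Rightarrow> real \<Rightarrow> real set \<Rightarrow> real \<Rightarrow> real" where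
  "brickwall \<alpha>0 \<alpha>1 W \<omega> = (if \<omega> \<in> W then \<alpha>0 else \<alpha>1)"

end

theory Submission
  imports Defs "HOL-Probability.Probability"
begin

text \<open>
  Boundedness of \<open>q\<close> makes the cubic term tractable: the inner integral is the autocorrelation of \<open>Q\<close>,
  which is almost everywhere \<open>2 \<pi>\<close> times the transform of \<open>|q|\<^sup>2\<close>, so the double integral is
  \<open>4 \<pi>\<^sup>2\<close> times the transform of \<open>|q|\<^sup>2 q\<close>. By Parseval its contribution to the total energy balance
  vanishes, and its \<open>L\<^sup>2\<close> norm is at most \<open>4 \<pi>\<^sup>2 q\<^sub>m\<^sub>a\<^sub>x\<^sup>2\<close> times that of \<open>Q\<close>.

  Hence the energy never exceeds its initial value, uniformly in the attenuation \<open>\<alpha>\<^sub>1\<close> off the bands.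
  The out-of-band energy \<open>V\<close> satisfies \<open>V' \<le> - \<alpha>\<^sub>1 V + const\<close> and is therefore
  \<open>O(exp (- \<alpha>\<^sub>1 z) + 1 / \<alpha>\<^sub>1)\<close>. What the cubic term feeds into the bands it takes from outside, where
  Cauchy-Schwarz bounds it by a multiple of \<open>sqrt V\<close>; so in the limit the in-band energy decays exactly
  like \<open>exp (- \<alpha>\<^sub>0 z)\<close>.

  The equation holds only pointwise in \<open>\<omega>\<close>, so it is not clear a priori that the energy is locally bounded
  in \<open>z\<close>, which is needed to integrate the balance over \<open>z\<close>; a Baire category argument supplies this.
\<close>

section \<open>Square-integrable functions\<close>

text \<open>\<open>fourier_L2\<close> links q and Q only through Parseval against test functions in
  L1 and L2. Neither q nor Q need be integrable, so the transform of q cannot be written as an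
  integral. Gaussians are the way round this: damping by a Gaussian in time is mollification by a
  Gaussian in frequency, the damped signal is an admissible test function, and the width is sent to
  its limit at the end. Of Plancherel's theorem two inequalities are proved, and their factors 2 pi
  cancel.

  The error bounds may see the attenuation only as a rate of decay. Monotonicity of the total energy
  replaces every later energy by the initial one, and the cubic term enters through a constant built
  from \<gamma> and \<open>qmax\<close> alone. The out-of-band energy V is not small at z = 0, where
  its initial content has yet to die out. What is small is the integral of sqrt V over z: up to
  common factors the initial layer adds \<open>2 / \<alpha>1\<close> and the continuing leakage
  \<open>z * sqrt (K / \<alpha>1)\<close>.\<close>

definition sqnorm :: "(real \<Rightarrow> complex) \<Rightarrow> real" where
  "sqnorm f = (LINT x|lborel. (cmod (f x))\<^sup>2)"

lemma sqnorm_nonneg: "sqnorm f \<ge> 0"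
  unfolding sqnorm_def by (rule integral_nonneg_AE) simp

lemma borel_measurable_cnj [measurable]: "cnj \<in> borel_measurable borel"
  by (intro borel_measurable_continuous_onI continuous_intros)

lemma is_L2_measurable: "is_L2 f \<Longrightarrow> f \<in> borel_measurable borel"
  unfolding is_L2_def by simp

lemma is_L2_integrable_square: "is_L2 f \<Longrightarrow> integrable lborel (\<lambda>x. (cmod (f x))\<^sup>2)"
  unfolding is_L2_def by simp

lemma is_L2_dominated:
  assumes "is_L2 g" "f \<in> borel_measurable borel" "\<And>x. cmod (f x) \<le> C * cmod (g x)"
  shows "is_L2 f"
  unfolding is_L2_def
proof
  show "integrable lborel (\<lambda>x. (cmod (f x))\<^sup>2)"
  proof (rule Bochner_Integration.integrable_bound)
    show "integrable lborel (\<lambda>x. C\<^sup>2 * (cmod (g x))\<^sup>2)"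
      using is_L2_integrable_square[OF assms(1)] by simp
    show "AE x in lborel. norm ((cmod (f x))\<^sup>2) \<le> norm (C\<^sup>2 * (cmod (g x))\<^sup>2)"
      using power_mono[OF assms(3), of _ 2] by (simp add: power_mult_distrib)
  qed (use assms(2) in measurable)
qed (use assms(2) in simp)

lemma is_L2_norm_mult_integrable:
  assumes "is_L2 f" "is_L2 g"
  shows "integrable lborel (\<lambda>x. cmod (f x) * cmod (g x))"
proof (rule Bochner_Integration.integrable_bound)
  note [measurable] = is_L2_measurable[OF assms(1)] is_L2_measurable[OF assms(2)]
  show "integrable lborel (\<lambda>x. (cmod (f x))\<^sup>2 + (cmod (g x))\<^sup>2)"
    using assms[THEN is_L2_integrable_square] by simp
  show "(\<lambda>x. cmod (f x) * cmod (g x)) \<in> borel_measurable lborel" by measurable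
  have "a * b \<le> a\<^sup>2 + b\<^sup>2" for a b :: real
    using sum_squares_bound[of a b] sum_power2_ge_zero[of a b] by linarith
  then show "AE x in lborel. norm (cmod (f x) * cmod (g x)) \<le> norm ((cmod (f x))\<^sup>2 + (cmod (g x))\<^sup>2)"
    by (simp add: abs_mult)
qed

lemma is_L2_mult_integrable:
  assumes "is_L2 f" "is_L2 g"
  shows "integrable lborel (\<lambda>x. f x * g x)"
proof -
  note [measurable] = is_L2_measurable[OF assms(1)] is_L2_measurable[OF assms(2)]
  have "integrable lborel (\<lambda>x. norm (f x * g x))"
    using is_L2_norm_mult_integrable[OF assms] by (simp add: norm_mult)
  then show ?thesis
    by (rule integrable_norm_cancel) measurable
qed

lemma Cauchy_Schwarz_is_L2:
  assumes "is_L2 f" "is_L2 g"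
  shows "(LINT x|lborel. cmod (f x) * cmod (g x)) \<le> sqrt (sqnorm f) * sqrt (sqnorm g)"
proof -
  note [measurable] = is_L2_measurable[OF assms(1)] is_L2_measurable[OF assms(2)]
  \<comment> \<open>These weights balance the two squares: each contributes
    \<open>s\<^sup>2 * t\<^sup>2\<close>, so nonnegativity of the integral reads s t X \<le> (s
    t)^2.\<close>
  define s t X where "s = sqrt (sqnorm g)" and "t = sqrt (sqnorm f)"
    and "X = (LINT x|lborel. cmod (f x) * cmod (g x))"
  have s2: "s\<^sup>2 = sqnorm g" and t2: "t\<^sup>2 = sqnorm f" and nn: "s \<ge> 0" "t \<ge> 0"
    using sqnorm_nonneg by (auto simp: s_def t_def)
  note int = assms[THEN is_L2_integrable_square] is_L2_norm_mult_integrable[OF assms]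
  have "0 \<le> (LINT x|lborel. (s * cmod (f x) - t * cmod (g x))\<^sup>2)"
    by (rule integral_nonneg_AE) simp
  also have "\<dots> = (LINT x|lborel. s\<^sup>2 * (cmod (f x))\<^sup>2 + t\<^sup>2 * (cmod (g x))\<^sup>2
        - (2 * s * t) * (cmod (f x) * cmod (g x)))"
    by (rule Bochner_Integration.integral_cong) (auto simp: power2_eq_square algebra_simps)
  also have "\<dots> = s\<^sup>2 * t\<^sup>2 + t\<^sup>2 * s\<^sup>2 - 2 * s * t * X"
    using int by (simp add: X_def s2 t2 sqnorm_def)
  finally have le: "2 * ((s * t) * X) \<le> 2 * ((s * t) * (s * t))"
    by (simp add: power2_eq_square algebra_simps)
  \<comment> \<open>This covers the case in which s t cannot be cancelled: a function of norm 0
    vanishes almost everywhere.\<close>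
  have zero: "X = 0" if "sqnorm f = 0 \<or> sqnorm g = 0"
  proof -
    have "AE x in lborel. cmod (f x) * cmod (g x) = 0"
    proof (cases "sqnorm f = 0")
      case True
      then have "AE x in lborel. (cmod (f x))\<^sup>2 = 0"
        using integral_nonneg_eq_0_iff_AE[OF int(1)] by (simp add: sqnorm_def)
      then show ?thesis by eventually_elim simp
    next
      case False
      then have "AE x in lborel. (cmod (g x))\<^sup>2 = 0"
        using that integral_nonneg_eq_0_iff_AE[OF int(2)] by (simp add: sqnorm_def)
      then show ?thesis by eventually_elim simp
    qed
    then have "X = (LINT x|lborel. 0)"
      unfolding X_def by (subst integral_cong_AE[where g = "\<lambda>_. 0"]) auto
    then show ?thesis by simp
  qed
  show ?thesis
  proof (cases "s * t = 0")
    case True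
    then have "X = 0" by (intro zero) (auto simp: s2[symmetric] t2[symmetric])
    then show ?thesis using nn by (simp add: X_def[symmetric] s_def t_def)
  next
    case False
    then have "s * t > 0" using nn by (simp add: less_le)
    then have "X \<le> s * t" using le by (simp add: mult_le_cancel_left_pos)
    then show ?thesis by (simp add: X_def s_def t_def mult.commute)
  qed
qed

lemma is_L2_affine:
  assumes "is_L2 f" "c \<noteq> 0"
  shows "is_L2 (\<lambda>x. f (t + c * x))"
  using assms lborel_integrable_real_affine[OF is_L2_integrable_square[OF assms(1)] assms(2), of t]
  unfolding is_L2_def by (auto intro!: measurable_compose[of _ borel borel f])

lemma sqnorm_affine:
  assumes "c \<noteq> 0"
  shows "\<bar>c\<bar> * sqnorm (\<lambda>x. f (t + c * x)) = sqnorm f"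
  using lborel_integral_real_affine[OF assms, of "\<lambda>x. (cmod (f x))\<^sup>2" t] unfolding sqnorm_def by simp

section \<open>Fourier transform and autocorrelation\<close>

lemma FT_L1_integrable:
  assumes "integrable lborel \<phi>"
  shows "integrable lborel (\<lambda>t. \<phi> t * exp (- \<i> * complex_of_real (\<omega> * t)))"
proof (rule Bochner_Integration.integrable_bound[OF assms])
  show "AE t in lborel. norm (\<phi> t * exp (- \<i> * complex_of_real (\<omega> * t))) \<le> norm (\<phi> t)"
    by (simp add: norm_mult)
qed (use borel_measurable_integrable[OF assms] in measurable)

lemma measurable_FT_L1 [measurable]:
  assumes [measurable]: "\<phi> \<in> borel_measurable borel"
  shows "FT_L1 \<phi> \<in> borel_measurable borel"
  unfolding FT_L1_def by measurable

lemma norm_FT_L1_le: "cmod (FT_L1 \<phi> \<omega>) \<le> (LINT t|lborel. cmod (\<phi> t))"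
  unfolding FT_L1_def
  by (rule order_trans[OF integral_norm_bound]) (simp add: norm_mult)

lemma FT_L1_modulate:
  "FT_L1 (\<lambda>t. \<phi> t * exp (\<i> * complex_of_real (x * t))) \<omega> = FT_L1 \<phi> (\<omega> - x)"
  unfolding FT_L1_def
  by (rule Bochner_Integration.integral_cong) (auto simp: mult.assoc exp_add[symmetric] algebra_simps)

text \<open>The multiplication formula: the kernel is symmetric in time and frequency, so Fubini
  moves the transform from one factor to the other without a conjugation.\<close>

lemma FT_L1_exchange:
  assumes f: "integrable lborel f" and h: "integrable lborel h"
  shows "(LINT \<omega>|lborel. FT_L1 f \<omega> * h \<omega>) = (LINT t|lborel. f t * FT_L1 h t)"
proof -
  have [measurable]: "f \<in> borel_measurable borel" "h \<in> borel_measurable borel"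
    using assms by auto
  let ?k = "\<lambda>t \<omega>. f t * h \<omega> * exp (- \<i> * complex_of_real (\<omega> * t))"
  have "integrable (lborel \<Otimes>\<^sub>M lborel) (case_prod ?k)"
  proof (rule lborel_pair.Fubini_integrable)
    show "integrable lborel (\<lambda>x. \<integral>y. norm (case_prod ?k (x, y)) \<partial>lborel)"
      using f h by (simp add: norm_mult)
    have "integrable lborel (\<lambda>y. case_prod ?k (x, y))" for x
      using FT_L1_integrable[OF h, of x]
        integrable_mult_right[of "f x" lborel "\<lambda>y. h y * exp (- \<i> * complex_of_real (x * y))"]
      by (simp add: mult.assoc mult.commute[of x])
    then show "AE x in lborel. integrable lborel (\<lambda>y. case_prod ?k (x, y))" by simp
  qed measurable
  from lborel_pair.Fubini_integral[OF this]
  have *: "(LINT \<omega>|lborel. (LINT t|lborel. ?k t \<omega>)) = (LINT t|lborel. (LINT \<omega>|lborel. ?k t \<omega>))" .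
  have 1: "(LINT t|lborel. ?k t \<omega>) = FT_L1 f \<omega> * h \<omega>" for \<omega>
    unfolding FT_L1_def
    by (subst integral_mult_left_zero[symmetric]) (simp add: mult_ac)
  have 2: "(LINT \<omega>|lborel. ?k t \<omega>) = f t * FT_L1 h t" for t
    unfolding FT_L1_def
    by (subst integral_mult_right_zero[symmetric]) (simp add: mult_ac)
  show ?thesis using * unfolding 1 2 .
qed

section \<open>Gaussian integrals and a Bessel inequality for the transform\<close>

lemma gaussian_scaled_eq: "exp (- (\<epsilon> * t)\<^sup>2 / 2) = sqrt (2 * pi) * std_normal_density (0 + \<epsilon> * t)"
  by (simp add: std_normal_density_def)

lemma gaussian_integrable:
  assumes "\<epsilon> > (0::real)"
  shows "integrable lborel (\<lambda>t. exp (- (\<epsilon> * t)\<^sup>2 / 2))"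
  \<comment> \<open>The summand 0 in \<open>gaussian_scaled_eq\<close> produces the shape
    \<open>t + c * x\<close> of the affine substitution rules.\<close>
  unfolding gaussian_scaled_eq
  using assms by (intro integrable_mult_right lborel_integrable_real_affine) auto

lemma gaussian_integral:
  assumes "\<epsilon> > (0::real)"
  shows "(LINT t|lborel. exp (- (\<epsilon> * t)\<^sup>2 / 2)) = sqrt (2 * pi) / \<epsilon>"
proof -
  have "1 = \<epsilon> * (LINT t|lborel. std_normal_density (0 + \<epsilon> * t))"
    using lborel_integral_real_affine[of \<epsilon> std_normal_density 0] assms by simp
  then show ?thesis
    unfolding gaussian_scaled_eq using assms by (simp add: field_simps)
qed

text \<open>After the substitution u = \<epsilon> t this is the characteristic function of the
  standard normal law at \<open>- (v / \<epsilon>)\<close>.\<close>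

lemma FT_L1_gaussian:
  assumes "\<epsilon> > 0"
  shows "FT_L1 (\<lambda>t. complex_of_real (exp (- (\<epsilon> * t)\<^sup>2 / 2))) v
    = complex_of_real (sqrt (2 * pi) / \<epsilon> * exp (- (v / \<epsilon>)\<^sup>2 / 2))"
proof -
  define G where "G = (\<lambda>u. std_normal_density u *\<^sub>R iexp (- (v / \<epsilon>) * u))"
  have "complex_of_real (exp (- (v / \<epsilon>)\<^sup>2 / 2)) = char std_normal_distribution (- (v / \<epsilon>))"
    by (simp add: char_std_normal_distribution)
  also have "\<dots> = (LINT u|lborel. G u)"
    unfolding char_def G_def
    by (subst integral_density) (auto simp: normal_density_nonneg)
  also have "\<dots> = \<epsilon> *\<^sub>R (LINT t|lborel. G (0 + \<epsilon> * t))"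
    using assms by (subst lborel_integral_real_affine[of \<epsilon> _ 0]) auto
  also have "(LINT t|lborel. G (0 + \<epsilon> * t))
      = (LINT t|lborel. (complex_of_real (1 / sqrt (2 * pi))) *
         (complex_of_real (exp (- (\<epsilon> * t)\<^sup>2 / 2)) * exp (- \<i> * complex_of_real (v * t))))"
    using assms by (intro Bochner_Integration.integral_cong)
      (auto simp: G_def std_normal_density_def scaleR_conv_of_real exp_of_real[symmetric])
  also have "\<dots> = complex_of_real (1 / sqrt (2 * pi)) *
      FT_L1 (\<lambda>t. complex_of_real (exp (- (\<epsilon> * t)\<^sup>2 / 2))) v"
    unfolding FT_L1_def by (rule integral_mult_right_zero)
  finally show ?thesis
    using assms by (simp add: scaleR_conv_of_real field_simps)
qed

text \<open>It turns the conjugated factor of |FT \<phi>|^2 back into the transform of an integrable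
  function, so that \<open>FT_L1_exchange\<close> applies to it as well.\<close>

lemma FT_L1_cnj_reflect: "FT_L1 (\<lambda>t. cnj (\<phi> (- t))) \<omega> = cnj (FT_L1 \<phi> \<omega>)"
proof -
  have "FT_L1 (\<lambda>t. cnj (\<phi> (- t))) \<omega>
      = (LINT t|lborel. cnj (\<phi> (- (0 + (-1) * t))) * exp (- \<i> * complex_of_real (\<omega> * (0 + (-1) * t))))"
    unfolding FT_L1_def by (subst lborel_integral_real_affine[of "-1" _ 0]) auto
  also have "\<dots> = (LINT t|lborel. cnj (\<phi> t * exp (- \<i> * complex_of_real (\<omega> * t))))"
    by (simp add: exp_cnj)
  also have "\<dots> = cnj (FT_L1 \<phi> \<omega>)"
    unfolding FT_L1_def by (rule Bochner_Integration.integral_cnj)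
  finally show ?thesis .
qed

text \<open>The mass does not depend on \<epsilon>, which is why the bound derived from this kernel
  survives the removal of the damping.\<close>

lemma gaussian_kernel_integral:
  assumes "\<epsilon> > (0::real)"
  shows "(\<integral>\<^sup>+ t. ennreal (sqrt (2 * pi) / \<epsilon> * exp (- ((t + s) / \<epsilon>)\<^sup>2 / 2)) \<partial>lborel) = ennreal (2 * pi)"
proof -
  define k where "k = (\<lambda>t::real. sqrt (2 * pi) / \<epsilon> * exp (- (t / \<epsilon>)\<^sup>2 / 2))"
  have int: "integrable lborel k"
    using gaussian_integrable[of "1 / \<epsilon>"] assms unfolding k_def by (intro integrable_mult_right) auto
  have "(\<integral>\<^sup>+ t. ennreal (k (s + 1 * t)) \<partial>lborel) = (\<integral>\<^sup>+ t. ennreal (k t) \<partial>lborel)"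
    using nn_integral_real_affine[of "\<lambda>t. ennreal (k t)" 1 s] int by simp
  also have "\<dots> = ennreal (LINT t|lborel. k t)"
    by (rule nn_integral_eq_integral[OF int]) (use assms in \<open>simp add: k_def\<close>)
  also have "(LINT t|lborel. k t) = sqrt (2 * pi) / \<epsilon> * (sqrt (2 * pi) / (1 / \<epsilon>))"
    using gaussian_integral[of "1 / \<epsilon>"] assms unfolding k_def by simp
  also have "\<dots> = 2 * pi" using assms by simp
  finally show ?thesis by (simp add: k_def add.commute)
qed

text \<open>Damping with a Gaussian turns \<open>\<integral>|FT \<phi>|\<^sup>2\<close> into a double integral of \<open>\<phi>\<close> against a
  positive kernel of total mass \<open>2 \<pi>\<close>.\<close>

lemma gaussian_damped_bessel:
  assumes \<phi>: "integrable lborel \<phi>" "is_L2 \<phi>" and \<epsilon>: "\<epsilon> > 0"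
  shows "(\<integral>\<^sup>+ \<omega>. ennreal ((cmod (FT_L1 \<phi> \<omega>))\<^sup>2 * exp (- (\<epsilon> * \<omega>)\<^sup>2 / 2)) \<partial>lborel)
    \<le> ennreal (2 * pi * sqnorm \<phi>)"
proof -
  note [measurable] = is_L2_measurable[OF \<phi>(2)]
  define G where "G = (\<lambda>\<omega>. complex_of_real (exp (- (\<epsilon> * \<omega>)\<^sup>2 / 2)))"
  define k where "k = (\<lambda>v. sqrt (2 * pi) / \<epsilon> * exp (- (v / \<epsilon>)\<^sup>2 / 2))"
  define C where "C = (LINT t|lborel. cmod (\<phi> t))"
  \<comment> \<open>Pairing \<open>FT_L1 \<phi>\<close> with \<open>h\<close> gives the damped
    square integral. One exchange moves it to \<open>\<phi>\<close> and \<open>FT_L1 h\<close>; a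
    second one, in \<open>FTh\<close>, writes \<open>FT_L1 h\<close> as an integral of
    \<open>\<psi>\<close> against the kernel \<open>k\<close>.\<close>
  define h where "h = (\<lambda>\<omega>. cnj (FT_L1 \<phi> \<omega>) * G \<omega>)"
  define \<psi> where "\<psi> = (\<lambda>t. cnj (\<phi> (- t)))"
  have [measurable]: "k \<in> borel_measurable borel" unfolding k_def by measurable
  have k0: "k v \<ge> 0" for v using \<epsilon> by (simp add: k_def)
  have C0: "C \<ge> 0" unfolding C_def by (rule integral_nonneg_AE) simp
  have FTC: "cmod (FT_L1 \<phi> \<omega>) \<le> C" for \<omega>
    unfolding C_def by (rule norm_FT_L1_le)
  have G: "integrable lborel G"
    unfolding G_def using gaussian_integrable[OF \<epsilon>] by simp
  have \<psi>: "integrable lborel \<psi>"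
    unfolding \<psi>_def using lborel_integrable_real_affine[OF \<phi>(1), of "-1" 0] by simp
  have [measurable]: "\<psi> \<in> borel_measurable borel" using \<psi> by simp
  have h: "integrable lborel h"
  proof (rule Bochner_Integration.integrable_bound)
    show "integrable lborel (\<lambda>\<omega>. C * G \<omega>)" using G by simp
    show "AE \<omega> in lborel. norm (h \<omega>) \<le> norm (C * G \<omega>)"
      using FTC C0 by (auto simp: h_def norm_mult intro!: mult_right_mono)
  qed (unfold h_def G_def, measurable)
  have FTh: "FT_L1 h s = (LINT t|lborel. \<psi> t * complex_of_real (k (t + s)))" for s
  proof -
    have "FT_L1 h s = (LINT \<omega>|lborel. FT_L1 \<psi> \<omega> * (G \<omega> * exp (\<i> * complex_of_real ((- s) * \<omega>))))"
      unfolding h_def \<psi>_def FT_L1_cnj_reflect by (subst FT_L1_def) (simp add: mult.assoc)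
    also have "\<dots> = (LINT t|lborel. \<psi> t * FT_L1 (\<lambda>\<omega>. G \<omega> * exp (\<i> * complex_of_real ((- s) * \<omega>))) t)"
      by (rule FT_L1_exchange[OF \<psi>]) (use FT_L1_integrable[OF G, of s] in simp)
    also have "\<dots> = (LINT t|lborel. \<psi> t * complex_of_real (k (t + s)))"
      unfolding FT_L1_modulate unfolding G_def k_def FT_L1_gaussian[OF \<epsilon>] by simp
    finally show ?thesis .
  qed
  have FTh_int: "integrable lborel (\<lambda>s. \<phi> s * FT_L1 h s)"
  proof (rule Bochner_Integration.integrable_bound)
    show "integrable lborel (\<lambda>s. (LINT t|lborel. cmod (h t)) * \<phi> s)" using \<phi>(1) by simp
    have "(LINT t|lborel. cmod (h t)) \<ge> 0" by (rule integral_nonneg_AE) simp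
    then show "AE s in lborel. norm (\<phi> s * FT_L1 h s) \<le> norm ((LINT t|lborel. cmod (h t)) * \<phi> s)"
      using norm_FT_L1_le[of h] by (auto simp: norm_mult mult.commute intro!: mult_left_mono)
    show "(\<lambda>s. \<phi> s * FT_L1 h s) \<in> borel_measurable lborel"
      using measurable_FT_L1[of h] h by simp
  qed
  have eq: "(LINT \<omega>|lborel. complex_of_real ((cmod (FT_L1 \<phi> \<omega>))\<^sup>2 * exp (- (\<epsilon> * \<omega>)\<^sup>2 / 2)))
     = (LINT s|lborel. \<phi> s * FT_L1 h s)"
    using FT_L1_exchange[OF \<phi>(1) h] unfolding h_def G_def
    by (simp add: complex_norm_square mult.assoc del: of_real_power)
  have int: "integrable lborel (\<lambda>\<omega>. (cmod (FT_L1 \<phi> \<omega>))\<^sup>2 * exp (- (\<epsilon> * \<omega>)\<^sup>2 / 2))"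
  proof (rule Bochner_Integration.integrable_bound)
    show "integrable lborel (\<lambda>\<omega>. C\<^sup>2 * exp (- (\<epsilon> * \<omega>)\<^sup>2 / 2))"
      using gaussian_integrable[OF \<epsilon>] by simp
    show "AE \<omega> in lborel. norm ((cmod (FT_L1 \<phi> \<omega>))\<^sup>2 * exp (- (\<epsilon> * \<omega>)\<^sup>2 / 2))
        \<le> norm (C\<^sup>2 * exp (- (\<epsilon> * \<omega>)\<^sup>2 / 2))"
      using FTC by (auto simp: abs_mult power_mono intro!: mult_right_mono)
  qed measurable
  have kint: "(\<integral>\<^sup>+ t. ennreal (k (t + s)) \<partial>lborel) = ennreal (2 * pi)" for s
    unfolding k_def by (rule gaussian_kernel_integral[OF \<epsilon>])
  have sq: "(\<integral>\<^sup>+ s. ennreal ((cmod (\<phi> s))\<^sup>2) \<partial>lborel) = ennreal (sqnorm \<phi>)"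
    unfolding sqnorm_def using is_L2_integrable_square[OF \<phi>(2)] by (intro nn_integral_eq_integral) auto
  have "(\<integral>\<^sup>+ \<omega>. ennreal ((cmod (FT_L1 \<phi> \<omega>))\<^sup>2 * exp (- (\<epsilon> * \<omega>)\<^sup>2 / 2)) \<partial>lborel)
     = ennreal (LINT \<omega>|lborel. (cmod (FT_L1 \<phi> \<omega>))\<^sup>2 * exp (- (\<epsilon> * \<omega>)\<^sup>2 / 2))"
    by (rule nn_integral_eq_integral[OF int]) simp
  also have "\<dots> \<le> ennreal (cmod (LINT s|lborel. \<phi> s * FT_L1 h s))"
    unfolding eq[symmetric] integral_complex_of_real norm_of_real by (intro ennreal_leI) simp
  also have "\<dots> \<le> (\<integral>\<^sup>+ s. ennreal (cmod (\<phi> s * FT_L1 h s)) \<partial>lborel)"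
    by (rule integral_norm_bound_ennreal[OF FTh_int])
  also have "\<dots> \<le> (\<integral>\<^sup>+ s. (\<integral>\<^sup>+ t. ennreal (cmod (\<phi> s) * (cmod (\<psi> t) * k (t + s))) \<partial>lborel) \<partial>lborel)"
  proof (rule nn_integral_mono)
    fix s
    have "integrable lborel (\<lambda>t. \<psi> t * complex_of_real (k (t + s)))"
    proof (rule Bochner_Integration.integrable_bound)
      show "integrable lborel (\<lambda>t. sqrt (2 * pi) / \<epsilon> * \<psi> t)" using \<psi> by simp
      have "k v \<le> sqrt (2 * pi) / \<epsilon>" for v unfolding k_def by (rule mult_left_le) (use \<epsilon> in auto)
      then have "norm (\<psi> t * complex_of_real (k (t + s))) \<le> norm (complex_of_real (sqrt (2 * pi) / \<epsilon>) * \<psi> t)" for t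
        unfolding norm_mult norm_of_real using k0 \<epsilon>
        by (subst mult.commute) (intro mult_right_mono, auto)
      then show "AE t in lborel. norm (\<psi> t * complex_of_real (k (t + s))) \<le> norm (complex_of_real (sqrt (2 * pi) / \<epsilon>) * \<psi> t)"
        by (intro AE_I2)
    qed measurable
    from integral_norm_bound_ennreal[OF this]
    have "ennreal (cmod (FT_L1 h s)) \<le> (\<integral>\<^sup>+ t. ennreal (cmod (\<psi> t) * k (t + s)) \<partial>lborel)"
      unfolding FTh using k0 by (simp add: norm_mult)
    then have "ennreal (cmod (\<phi> s)) * ennreal (cmod (FT_L1 h s))
       \<le> ennreal (cmod (\<phi> s)) * (\<integral>\<^sup>+ t. ennreal (cmod (\<psi> t) * k (t + s)) \<partial>lborel)"
      by (rule mult_left_mono) simp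
    also have "\<dots> = (\<integral>\<^sup>+ t. ennreal (cmod (\<phi> s)) * ennreal (cmod (\<psi> t) * k (t + s)) \<partial>lborel)"
      by (rule nn_integral_cmult[symmetric]) measurable
    finally show "ennreal (cmod (\<phi> s * FT_L1 h s))
       \<le> (\<integral>\<^sup>+ t. ennreal (cmod (\<phi> s) * (cmod (\<psi> t) * k (t + s))) \<partial>lborel)"
      using k0 by (simp add: norm_mult ennreal_mult)
  qed
  \<comment> \<open>Young's inequality separates the two factors. Each half then pairs a single
    square with the whole mass 2 pi of the kernel and contributes
    \<open>pi * sqnorm \<phi>\<close>.\<close>
  also have "\<dots> \<le> (\<integral>\<^sup>+ s. (\<integral>\<^sup>+ t. ennreal ((cmod (\<phi> s))\<^sup>2 / 2) * ennreal (k (t + s))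
        + ennreal ((cmod (\<psi> t))\<^sup>2 / 2) * ennreal (k (t + s)) \<partial>lborel) \<partial>lborel)"
  proof (intro nn_integral_mono)
    fix s t
    have "cmod (\<phi> s) * cmod (\<psi> t) \<le> (cmod (\<phi> s))\<^sup>2 / 2 + (cmod (\<psi> t))\<^sup>2 / 2"
      using sum_squares_bound[of "cmod (\<phi> s)" "cmod (\<psi> t)"] by simp
    then have "cmod (\<phi> s) * cmod (\<psi> t) * k (t + s)
        \<le> ((cmod (\<phi> s))\<^sup>2 / 2 + (cmod (\<psi> t))\<^sup>2 / 2) * k (t + s)"
      by (rule mult_right_mono[OF _ k0])
    then show "ennreal (cmod (\<phi> s) * (cmod (\<psi> t) * k (t + s))) \<le>
       ennreal ((cmod (\<phi> s))\<^sup>2 / 2) * ennreal (k (t + s)) + ennreal ((cmod (\<psi> t))\<^sup>2 / 2) * ennreal (k (t + s))"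
      using k0 by (simp add: ennreal_mult[symmetric] ennreal_plus[symmetric] ennreal_leI algebra_simps del: ennreal_plus)
  qed
  also have "\<dots> = (\<integral>\<^sup>+ s. (\<integral>\<^sup>+ t. ennreal ((cmod (\<phi> s))\<^sup>2 / 2) * ennreal (k (t + s)) \<partial>lborel) \<partial>lborel)
        + (\<integral>\<^sup>+ s. (\<integral>\<^sup>+ t. ennreal ((cmod (\<psi> t))\<^sup>2 / 2) * ennreal (k (t + s)) \<partial>lborel) \<partial>lborel)"
    by (subst nn_integral_add[symmetric]; (simp add: nn_integral_add)?)
  also have "(\<integral>\<^sup>+ s. (\<integral>\<^sup>+ t. ennreal ((cmod (\<phi> s))\<^sup>2 / 2) * ennreal (k (t + s)) \<partial>lborel) \<partial>lborel)
      = ennreal (pi * sqnorm \<phi>)"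
  proof -
    have "(\<integral>\<^sup>+ s. (\<integral>\<^sup>+ t. ennreal ((cmod (\<phi> s))\<^sup>2 / 2) * ennreal (k (t + s)) \<partial>lborel) \<partial>lborel)
       = (\<integral>\<^sup>+ s. ennreal pi * ennreal ((cmod (\<phi> s))\<^sup>2) \<partial>lborel)"
      by (simp add: nn_integral_cmult kint ennreal_mult[symmetric] mult.commute[of pi])
    then show ?thesis by (simp add: nn_integral_cmult sq ennreal_mult sqnorm_nonneg)
  qed
  also have "(\<integral>\<^sup>+ s. (\<integral>\<^sup>+ t. ennreal ((cmod (\<psi> t))\<^sup>2 / 2) * ennreal (k (t + s)) \<partial>lborel) \<partial>lborel)
      = ennreal (pi * sqnorm \<phi>)"
  proof -
    have "(\<integral>\<^sup>+ s. (\<integral>\<^sup>+ t. ennreal ((cmod (\<psi> t))\<^sup>2 / 2) * ennreal (k (t + s)) \<partial>lborel) \<partial>lborel)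
       = (\<integral>\<^sup>+ t. (\<integral>\<^sup>+ s. ennreal ((cmod (\<psi> t))\<^sup>2 / 2) * ennreal (k (s + t)) \<partial>lborel) \<partial>lborel)"
      by (subst lborel_pair.Fubini') (auto simp: add.commute)
    also have "\<dots> = (\<integral>\<^sup>+ t. ennreal pi * ennreal ((cmod (\<psi> t))\<^sup>2) \<partial>lborel)"
      by (simp add: nn_integral_cmult kint ennreal_mult[symmetric] mult.commute[of pi])
    also have "\<dots> = ennreal pi * (\<integral>\<^sup>+ t. ennreal ((cmod (\<phi> (0 + (-1) * t)))\<^sup>2) \<partial>lborel)"
      by (simp add: nn_integral_cmult \<psi>_def)
    also have "(\<integral>\<^sup>+ t. ennreal ((cmod (\<phi> (0 + (-1) * t)))\<^sup>2) \<partial>lborel) = ennreal (sqnorm \<phi>)"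
      using nn_integral_real_affine[of "\<lambda>t. ennreal ((cmod (\<phi> t))\<^sup>2)" "-1" 0] sq by simp
    finally show ?thesis by (simp add: ennreal_mult sqnorm_nonneg)
  qed
  also have "ennreal (pi * sqnorm \<phi>) + ennreal (pi * sqnorm \<phi>) = ennreal (2 * pi * sqnorm \<phi>)"
    by (simp add: ennreal_plus[symmetric] sqnorm_nonneg del: ennreal_plus)
  finally show ?thesis .
qed

text \<open>Fatou's lemma as the damping is switched off, the bound being the same for every width.
  This is one half of Plancherel for functions in L1 and L2.\<close>

lemma
  assumes \<phi>: "integrable lborel \<phi>" "is_L2 \<phi>"
  shows is_L2_FT_L1: "is_L2 (FT_L1 \<phi>)"
    and sqnorm_FT_L1_le: "sqnorm (FT_L1 \<phi>) \<le> 2 * pi * sqnorm \<phi>"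
proof -
  note [measurable] = is_L2_measurable[OF \<phi>(2)]
  let ?F = "\<lambda>\<omega>. (cmod (FT_L1 \<phi> \<omega>))\<^sup>2"
  let ?G = "\<lambda>n \<omega>. ?F \<omega> * exp (- (1 / real (Suc n) * \<omega>)\<^sup>2 / 2)"
  have lim: "(\<lambda>n. ennreal (?G n \<omega>)) \<longlonglongrightarrow> ennreal (?F \<omega>)" for \<omega>
  proof -
    have "(\<lambda>n. 1 / real (Suc n)) \<longlonglongrightarrow> 0" by (rule lim_1_over_n[THEN LIMSEQ_Suc])
    then have "(\<lambda>n. ?G n \<omega>) \<longlonglongrightarrow> ?F \<omega> * exp (- (0 * \<omega>)\<^sup>2 / 2)"
      by (intro tendsto_intros) auto
    then show ?thesis by simp
  qed
  have "(\<integral>\<^sup>+ \<omega>. ennreal (?F \<omega>) \<partial>lborel) = (\<integral>\<^sup>+ \<omega>. liminf (\<lambda>n. ennreal (?G n \<omega>)) \<partial>lborel)"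
    by (intro nn_integral_cong) (use lim_imp_Liminf[OF _ lim] in simp)
  also have "\<dots> \<le> liminf (\<lambda>n. \<integral>\<^sup>+ \<omega>. ennreal (?G n \<omega>) \<partial>lborel)"
    by (rule nn_integral_liminf) measurable
  also have "\<dots> \<le> liminf (\<lambda>n. ennreal (2 * pi * sqnorm \<phi>))"
    by (intro Liminf_mono always_eventually allI gaussian_damped_bessel[OF \<phi>]) auto
  also have "\<dots> = ennreal (2 * pi * sqnorm \<phi>)" by (rule Liminf_const) simp
  finally have le: "(\<integral>\<^sup>+ \<omega>. ennreal (?F \<omega>) \<partial>lborel) \<le> ennreal (2 * pi * sqnorm \<phi>)" .
  then have int: "integrable lborel ?F"
    by (intro integrableI_bounded) (auto intro: le_less_trans)
  then show "is_L2 (FT_L1 \<phi>)" unfolding is_L2_def by simp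
  have "ennreal (sqnorm (FT_L1 \<phi>)) \<le> ennreal (2 * pi * sqnorm \<phi>)"
    using le nn_integral_eq_integral[OF int] by (simp add: sqnorm_def)
  then show "sqnorm (FT_L1 \<phi>) \<le> 2 * pi * sqnorm \<phi>"
    by (simp add: sqnorm_nonneg)
qed

section \<open>Recovering a bounded function from its interval integrals and mollifications\<close>

text \<open>Adding the bound C makes f + C and the constant C nonnegative, hence densities. Cut off
  to (-n, n] they define finite measures that agree on all half lines; so the measures coincide, and
  then the densities almost everywhere.\<close>

lemma AE_eq_0_if_interval_integrals_0:
  fixes f :: "real \<Rightarrow> real"
  assumes [measurable]: "f \<in> borel_measurable borel"
    and bound: "\<And>x. \<bar>f x\<bar> \<le> C"
    and zero: "\<And>a b. a < b \<Longrightarrow> (LINT x|lborel. indicator {a<..b} x * f x) = 0"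
  shows "AE x in lborel. f x = 0"
proof -
  have int: "integrable lborel (\<lambda>x. indicator {a<..b} x * g x)"
    if [measurable]: "g \<in> borel_measurable borel" and g: "\<And>x. \<bar>g x\<bar> \<le> D"
    for a b D :: real and g :: "real \<Rightarrow> real"
  proof (rule Bochner_Integration.integrable_bound)
    show "integrable lborel (\<lambda>x. D * indicator {a<..b} x)" by (cases "a \<le> b") auto
    have "0 \<le> D" using g[of 0] by simp
    then show "AE x in lborel. norm (indicator {a<..b} x * g x) \<le> norm (D * indicator {a<..b} x)"
      using g by (auto simp: indicator_def)
  qed measurable
  have C: "C \<ge> 0" using bound[of 0] by simp
  have "AE x in lborel. indicator {- real n<..real n} x * f x = 0" for n
  proof -
    define g where "g = (\<lambda>x. indicator {- real n<..real n} x * (f x + C))"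
    define h where "h = (\<lambda>x. indicator {- real n<..real n} x * C)"
    have [measurable]: "g \<in> borel_measurable borel" "h \<in> borel_measurable borel"
      unfolding g_def h_def by measurable
    have nn: "g x \<ge> 0" "h x \<ge> 0" for x
      using bound[of x] C by (auto simp: g_def h_def indicator_def)
    have emg: "emeasure (density lborel (\<lambda>x. ennreal (k x))) {y<..}
        = ennreal (LINT x|lborel. indicator {max y (- real n)<..real n} x * k' x)"
      if k: "k = (\<lambda>x. indicator {- real n<..real n} x * k' x)" "\<And>x. k x \<ge> 0" "\<And>x. \<bar>k' x\<bar> \<le> D"
        and [measurable]: "k' \<in> borel_measurable borel" for k k' :: "real \<Rightarrow> real" and y D
    proof -
      have [measurable]: "k \<in> borel_measurable borel" unfolding k(1) by measurable
      have "emeasure (density lborel (\<lambda>x. ennreal (k x))) {y<..}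
          = (\<integral>\<^sup>+ x. ennreal (k x) * indicator {y<..} x \<partial>lborel)"
        by (rule emeasure_density) auto
      also have "\<dots> = (\<integral>\<^sup>+ x. ennreal (indicator {max y (- real n)<..real n} x * k' x) \<partial>lborel)"
        by (intro nn_integral_cong) (auto simp: k(1) indicator_def)
      also have "\<dots> = ennreal (LINT x|lborel. indicator {max y (- real n)<..real n} x * k' x)"
      proof (rule nn_integral_eq_integral[OF int[OF _ k(3)]])
        have "0 \<le> indicator {max y (- real n)<..real n} x * k' x" for x
          using k(2)[of x] unfolding k(1) by (auto simp: indicator_def split: if_splits)
        then show "AE x in lborel. 0 \<le> indicator {max y (- real n)<..real n} x * k' x" by simp
      qed measurable
      finally show ?thesis .
    qed
    have int_eq: "(LINT x|lborel. indicator {y<..z} x * (f x + C)) = (LINT x|lborel. indicator {y<..z} x * C)" for y z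
    proof -
      have "(LINT x|lborel. indicator {y<..z} x * (f x + C))
         = (LINT x|lborel. indicator {y<..z} x * f x) + (LINT x|lborel. indicator {y<..z} x * C)"
        using int[of f C y z] int[of "\<lambda>_. C" C y z] bound C by (simp add: distrib_left)
      also have "(LINT x|lborel. indicator {y<..z} x * f x) = 0"
        using zero[of y z] by (cases "y < z") auto
      finally show ?thesis by simp
    qed
    have g: "emeasure (density lborel (\<lambda>x. ennreal (g x))) {y<..}
        = ennreal (LINT x|lborel. indicator {max y (- real n)<..real n} x * (f x + C))" for y
    proof (rule emg[OF g_def nn(1)])
      show "\<bar>f x + C\<bar> \<le> 2 * C" for x using bound[of x] by linarith
    qed measurable
    have h: "emeasure (density lborel (\<lambda>x. ennreal (h x))) {y<..}
        = ennreal (LINT x|lborel. indicator {max y (- real n)<..real n} x * C)" for y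
      by (rule emg[OF h_def nn(2), of C]) (use C in auto)
    have "density lborel (\<lambda>x. ennreal (g x)) = density lborel (\<lambda>x. ennreal (h x))"
      by (rule measure_eqI_lessThan) (auto simp: g h int_eq)
    then have "AE x in lborel. ennreal (g x) = ennreal (h x)"
      by (subst (asm) sigma_finite_measure.density_unique_iff[OF sigma_finite_lborel]) auto
    then show ?thesis
      by eventually_elim (use nn in \<open>auto simp: g_def h_def indicator_def\<close>)
  qed
  then have "AE x in lborel. \<forall>n. indicator {- real n<..real n} x * f x = 0"
    by (subst AE_all_countable) blast
  then show ?thesis
  proof eventually_elim
    case (elim x)
    obtain n where "\<bar>x\<bar> < real n" using reals_Archimedean2 by blast
    then show ?case using elim[rule_format, of n] by (auto simp: indicator_def)
  qed
qed

lemma integrable_interval_bounded: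
  fixes f :: "real \<Rightarrow> complex"
  assumes [measurable]: "f \<in> borel_measurable borel" and bound: "\<And>x. cmod (f x) \<le> C"
  shows "integrable lborel (\<lambda>x. indicator {a<..b} x *\<^sub>R f x)"
proof (rule Bochner_Integration.integrable_bound)
  show "integrable lborel (\<lambda>x. C * indicator {a<..b} x)" by (cases "a \<le> b") auto
  have "0 \<le> C" using order_trans[OF norm_ge_zero bound] .
  then show "AE x in lborel. norm (indicator {a<..b} x *\<^sub>R f x) \<le> norm (C * indicator {a<..b} x)"
    using bound by (auto simp: indicator_def)
qed measurable

text \<open>A need not be continuous: the shift is moved from A to the ends of the interval, and the
  shifted indicators converge at every point other than the two ends.\<close>

lemma interval_integral_shift_tendsto:
  fixes A :: "real \<Rightarrow> complex"
  assumes A[measurable]: "A \<in> borel_measurable borel" and bound: "\<And>x. cmod (A x) \<le> C"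
    and \<delta>: "\<delta> \<longlonglongrightarrow> 0"
  shows "(\<lambda>n. LINT x|lborel. indicator {a<..b} x *\<^sub>R A (x - \<delta> n)) \<longlonglongrightarrow>
     (LINT x|lborel. indicator {a<..b} x *\<^sub>R A x)"
proof -
  have C: "0 \<le> C" using order_trans[OF norm_ge_zero bound] .
  have shift: "(LINT x|lborel. indicator {a<..b} x *\<^sub>R A (x - d))
      = (LINT x|lborel. indicator {a - d<..b - d} x *\<^sub>R A x)" for d
    by (subst lborel_integral_real_affine[of 1 _ d])
       (auto intro!: Bochner_Integration.integral_cong simp: indicator_def)
  obtain B where B: "\<And>n. \<bar>\<delta> n\<bar> \<le> B"
    using Bseq_def convergent_imp_Bseq convergentI[OF \<delta>] by (metis real_norm_def)
  show ?thesis
    unfolding shift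
  proof (rule integral_dominated_convergence)
    show "integrable lborel (\<lambda>x. C * indicator {a - B<..b + B} x :: real)"
      by (cases "a - B \<le> b + B") auto
    show "AE x in lborel. norm (indicator {a - \<delta> n<..b - \<delta> n} x *\<^sub>R A x) \<le> C * indicator {a - B<..b + B} x" for n
      using B[of n] bound C by (auto simp: indicator_def)
    have "AE x in lborel. x \<noteq> a \<and> x \<noteq> b"
      using AE_lborel_singleton[of a] AE_lborel_singleton[of b] by eventually_elim auto
    then show "AE x in lborel. (\<lambda>n. indicator {a - \<delta> n<..b - \<delta> n} x *\<^sub>R A x)
        \<longlonglongrightarrow> indicator {a<..b} x *\<^sub>R A x"
    proof eventually_elim
      case (elim x)
      have lims: "(\<lambda>n. a - \<delta> n) \<longlonglongrightarrow> a - 0" "(\<lambda>n. b - \<delta> n) \<longlonglongrightarrow> b - 0"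
        by (rule tendsto_diff[OF tendsto_const \<delta>])+
      have "\<forall>\<^sub>F n in sequentially. (a - \<delta> n < x) = (a < x)"
        using order_tendstoD[OF lims(1), of x] elim
        by (cases "a < x") (auto elim: eventually_mono)
      moreover have "\<forall>\<^sub>F n in sequentially. (x \<le> b - \<delta> n) = (x \<le> b)"
        using order_tendstoD[OF lims(2), of x] elim
        by (cases "x < b") (auto elim: eventually_mono)
      ultimately have "\<forall>\<^sub>F n in sequentially. indicator {a - \<delta> n<..b - \<delta> n} x *\<^sub>R A x = indicator {a<..b} x *\<^sub>R A x"
        by eventually_elim (auto simp: indicator_def)
      then show ?case by (rule tendsto_eventually)
    qed
  qed measurable
qed

text \<open>Integrated over an interval, the mollification becomes an average of shifted interval
  integrals, which converge without any regularity of A. The pointwise limit S must give the same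
  interval integrals, and these determine a bounded function almost everywhere.\<close>

lemma AE_eq_gaussian_mollification_limit:
  fixes A S :: "real \<Rightarrow> complex" and T :: "nat \<Rightarrow> real \<Rightarrow> complex"
  assumes A[measurable]: "A \<in> borel_measurable borel" and bound: "\<And>x. cmod (A x) \<le> C"
    and T: "\<And>n x. (LINT u|lborel. std_normal_density u *\<^sub>R A (x - u / real (Suc n))) = T n x"
    and lim: "\<And>x. (\<lambda>n. T n x) \<longlonglongrightarrow> S x"
  shows "AE x in lborel. A x = S x"
proof -
  have C: "0 \<le> C" using order_trans[OF norm_ge_zero bound] .
  have Tm[measurable]: "T n \<in> borel_measurable borel" for n
    unfolding T[symmetric] by measurable
  have Sm[measurable]: "S \<in> borel_measurable borel"
    by (rule borel_measurable_LIMSEQ_metric[OF Tm lim])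
  have Tb: "cmod (T n x) \<le> C" for n x
  proof -
    have "cmod (T n x) \<le> (LINT u|lborel. norm (std_normal_density u *\<^sub>R A (x - u / real (Suc n))))"
      unfolding T[symmetric] by (rule integral_norm_bound)
    also have "\<dots> \<le> (LINT u|lborel. std_normal_density u * C)"
    proof (rule integral_mono)
      show "integrable lborel (\<lambda>u. norm (std_normal_density u *\<^sub>R A (x - u / real (Suc n))))"
        by (rule Bochner_Integration.integrable_bound[of _ "\<lambda>u. std_normal_density u * C"])
           (use bound C in \<open>auto intro!: mult_left_mono\<close>)
    qed (use bound in \<open>auto intro!: mult_left_mono\<close>)
    finally show ?thesis by simp
  qed
  have Sb: "cmod (S x) \<le> C" for x
    using Tb by (intro tendsto_upperbound[OF tendsto_norm[OF lim]]) auto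
  have "(LINT x|lborel. indicator {a<..b} x *\<^sub>R A x) = (LINT x|lborel. indicator {a<..b} x *\<^sub>R S x)"
    if "a < b" for a b
  proof -
    let ?J = "\<lambda>d. LINT x|lborel. indicator {a<..b} x *\<^sub>R A (x - d)"
    have eq: "(LINT x|lborel. indicator {a<..b} x *\<^sub>R T n x)
        = (LINT u|lborel. std_normal_density u *\<^sub>R ?J (u / real (Suc n)))" for n
    proof -
      let ?k = "\<lambda>u x. std_normal_density u *\<^sub>R (indicator {a<..b} x *\<^sub>R A (x - u / real (Suc n)))"
      have "integrable (lborel \<Otimes>\<^sub>M lborel) (case_prod ?k)"
      proof (rule Bochner_Integration.integrable_bound)
        show "integrable (lborel \<Otimes>\<^sub>M lborel) (\<lambda>(u, x). std_normal_density u * (C * indicator {a<..b} x))"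
          by (rule lborel_pair.Fubini_integrable) (use that C in \<open>auto simp: abs_mult\<close>)
        have "norm (?k u x) \<le> norm (std_normal_density u * (C * indicator {a<..b} x))" for u x
          using bound C by (auto simp: abs_mult indicator_def intro!: mult_left_mono)
        then show "AE p in lborel \<Otimes>\<^sub>M lborel. norm (case_prod ?k p)
            \<le> norm (case p of (u, x) \<Rightarrow> std_normal_density u * (C * indicator {a<..b} x))"
          by (intro AE_I2) (simp only: split_beta)
      qed measurable
      from lborel_pair.Fubini_integral[OF this]
      have "(LINT x|lborel. (LINT u|lborel. ?k u x)) = (LINT u|lborel. (LINT x|lborel. ?k u x))" .
      moreover have "(LINT u|lborel. ?k u x) = indicator {a<..b} x *\<^sub>R T n x" for x
        unfolding T[symmetric] integral_scaleR_right[symmetric] by (simp add: mult.commute)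
      moreover have "(LINT x|lborel. ?k u x) = std_normal_density u *\<^sub>R ?J (u / real (Suc n))" for u
        by (rule integral_scaleR_right)
      ultimately show ?thesis by simp
    qed
    have "(\<lambda>n. LINT u|lborel. std_normal_density u *\<^sub>R ?J (u / real (Suc n)))
        \<longlonglongrightarrow> (LINT u|lborel. std_normal_density u *\<^sub>R ?J 0)"
    proof (rule integral_dominated_convergence)
      show "integrable lborel (\<lambda>u. std_normal_density u * (C * (b - a)))" by simp
      have "(\<lambda>n. ?J (u / real (Suc n))) \<longlonglongrightarrow> ?J 0" for u
      proof -
        have "(\<lambda>n. u / real (Suc n)) \<longlonglongrightarrow> 0"
          by (rule lim_const_over_n[THEN LIMSEQ_Suc])
        from interval_integral_shift_tendsto[OF A bound this] show ?thesis by simp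
      qed
      then show "AE u in lborel. (\<lambda>n. std_normal_density u *\<^sub>R ?J (u / real (Suc n))) \<longlonglongrightarrow> std_normal_density u *\<^sub>R ?J 0"
        by (intro AE_I2 tendsto_intros) auto
      have "cmod (?J d) \<le> C * (b - a)" for d
      proof -
        have "cmod (?J d) \<le> (LINT x|lborel. norm (indicator {a<..b} x *\<^sub>R A (x - d)))"
          by (rule integral_norm_bound)
        also have "\<dots> \<le> (LINT x|lborel. C * indicator {a<..b} x)"
        proof (rule integral_mono)
          show "integrable lborel (\<lambda>x. norm (indicator {a<..b} x *\<^sub>R A (x - d)))"
            by (intro integrable_norm integrable_interval_bounded[of _ C]) (use bound in auto)
          show "integrable lborel (\<lambda>x. C * indicator {a<..b} x)" using that by simp
        qed (use bound C in \<open>auto simp: indicator_def\<close>)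
        finally show ?thesis using that by simp
      qed
      then show "AE u in lborel. norm (std_normal_density u *\<^sub>R ?J (u / real (Suc n))) \<le> std_normal_density u * (C * (b - a))" for n
        by (auto intro!: mult_left_mono)
    qed measurable
    then have "(\<lambda>n. LINT x|lborel. indicator {a<..b} x *\<^sub>R T n x) \<longlonglongrightarrow> (LINT x|lborel. indicator {a<..b} x *\<^sub>R A x)"
      unfolding eq by simp
    moreover have "(\<lambda>n. LINT x|lborel. indicator {a<..b} x *\<^sub>R T n x) \<longlonglongrightarrow> (LINT x|lborel. indicator {a<..b} x *\<^sub>R S x)"
    proof (rule integral_dominated_convergence)
      show "integrable lborel (\<lambda>x. C * indicator {a<..b} x :: real)" using that by simp
      show "AE x in lborel. (\<lambda>n. indicator {a<..b} x *\<^sub>R T n x) \<longlonglongrightarrow> indicator {a<..b} x *\<^sub>R S x"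
        using lim by (intro AE_I2 tendsto_intros) auto
      show "AE x in lborel. norm (indicator {a<..b} x *\<^sub>R T n x) \<le> C * indicator {a<..b} x" for n
        using Tb C by (auto simp: indicator_def)
    qed measurable
    ultimately show ?thesis by (rule LIMSEQ_unique)
  qed note eq = this
  have D: "(LINT x|lborel. indicator {a<..b} x *\<^sub>R (A x - S x)) = 0" if "a < b" for a b
    using eq[OF that] integrable_interval_bounded[OF A bound, of a b] integrable_interval_bounded[OF Sm Sb, of a b]
    by (simp add: scaleR_diff_right)
  have intD: "integrable lborel (\<lambda>x. indicator {a<..b} x *\<^sub>R (A x - S x))" for a b
    using integrable_interval_bounded[OF A bound, of a b] integrable_interval_bounded[OF Sm Sb, of a b]
    by (simp add: scaleR_diff_right)
  have DC: "cmod (A x - S x) \<le> 2 * C" for x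
    using norm_triangle_ineq4[of "A x" "S x"] bound[of x] Sb[of x] by linarith
  have "AE x in lborel. Re (A x - S x) = 0"
  proof (rule AE_eq_0_if_interval_integrals_0)
    show "\<bar>Re (A x - S x)\<bar> \<le> 2 * C" for x using order_trans[OF abs_Re_le_cmod DC] .
    show "(LINT x|lborel. indicator {a<..b} x * Re (A x - S x)) = 0" if "a < b" for a b
      using integral_Re[OF intD[of a b]] D[OF that] by simp
  qed measurable
  moreover have "AE x in lborel. Im (A x - S x) = 0"
  proof (rule AE_eq_0_if_interval_integrals_0)
    show "\<bar>Im (A x - S x)\<bar> \<le> 2 * C" for x using order_trans[OF abs_Im_le_cmod DC] .
    show "(LINT x|lborel. indicator {a<..b} x * Im (A x - S x)) = 0" if "a < b" for a b
      using integral_Im[OF intD[of a b]] D[OF that] by simp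
  qed measurable
  ultimately show ?thesis
    by eventually_elim (simp add: complex_eq_iff)
qed

section \<open>Fourier pairs in L2: modulation and mollification\<close>

lemma fourier_L2_parseval:
  assumes "fourier_L2 q Q" "integrable lborel \<phi>" "is_L2 \<phi>"
  shows "(LINT \<omega>|lborel. Q \<omega> * cnj (FT_L1 \<phi> \<omega>)) = complex_of_real (2 * pi) * (LINT t|lborel. q t * cnj (\<phi> t))"
  using assms unfolding fourier_L2_def by blast

lemma fourier_L2_is_L2: "fourier_L2 q Q \<Longrightarrow> is_L2 q" "fourier_L2 q Q \<Longrightarrow> is_L2 Q"
  unfolding fourier_L2_def by blast+

lemma integrable_modulate:
  assumes "integrable lborel \<phi>"
  shows "integrable lborel (\<lambda>t. \<phi> t * exp (\<i> * complex_of_real (x * t)))"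
  using FT_L1_integrable[OF assms, of "- x"] by simp

lemma is_L2_modulate:
  assumes "is_L2 \<phi>"
  shows "is_L2 (\<lambda>t. \<phi> t * exp (\<i> * complex_of_real (x * t)))"
  using is_L2_measurable[OF assms]
  by (intro is_L2_dominated[OF assms, of _ 1]) (simp_all add: norm_mult)

text \<open>It makes the shifted spectrum in the autocorrelation a member of a Fourier pair, so that
  Parseval applies to it.\<close>

lemma fourier_L2_modulate:
  assumes "fourier_L2 q Q"
  shows "fourier_L2 (\<lambda>t. q t * exp (- \<i> * complex_of_real (x * t))) (\<lambda>\<omega>. Q (x + \<omega>))"
  unfolding fourier_L2_def
proof (intro conjI allI impI)
  show "is_L2 (\<lambda>t. q t * exp (- \<i> * complex_of_real (x * t)))"
    using is_L2_modulate[OF fourier_L2_is_L2(1)[OF assms], of "- x"] by simp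
  show "is_L2 (\<lambda>\<omega>. Q (x + \<omega>))"
    using is_L2_affine[OF fourier_L2_is_L2(2)[OF assms], of 1 x] by simp
  fix \<phi> assume \<phi>: "integrable lborel \<phi> \<and> is_L2 \<phi>"
  have "(LINT \<omega>|lborel. Q (x + \<omega>) * cnj (FT_L1 \<phi> \<omega>)) = (LINT \<omega>|lborel. Q \<omega> * cnj (FT_L1 \<phi> (\<omega> - x)))"
    by (subst (2) lborel_integral_real_affine[of 1 _ x]) auto
  also have "\<dots> = (LINT \<omega>|lborel. Q \<omega> * cnj (FT_L1 (\<lambda>t. \<phi> t * exp (\<i> * complex_of_real (x * t))) \<omega>))"
    unfolding FT_L1_modulate ..
  also have "\<dots> = complex_of_real (2 * pi) * (LINT t|lborel. q t * cnj (\<phi> t * exp (\<i> * complex_of_real (x * t))))"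
    using \<phi> by (intro fourier_L2_parseval[OF assms] integrable_modulate is_L2_modulate) auto
  finally show "(LINT \<omega>|lborel. Q (x + \<omega>) * cnj (FT_L1 \<phi> \<omega>)) =
     complex_of_real (2 * pi) * (LINT t|lborel. q t * exp (- \<i> * complex_of_real (x * t)) * cnj (\<phi> t))"
    by (simp add: exp_cnj mult_ac)
qed

lemma is_L2_gaussian:
  assumes "\<epsilon> > 0"
  shows "is_L2 (\<lambda>t. complex_of_real (exp (- (\<epsilon> * t)\<^sup>2 / 2)))"
  unfolding is_L2_def
proof
  show "integrable lborel (\<lambda>t. (cmod (complex_of_real (exp (- (\<epsilon> * t)\<^sup>2 / 2))))\<^sup>2)"
  proof (rule Bochner_Integration.integrable_bound[OF gaussian_integrable[OF assms]])
    have "(exp (- (\<epsilon> * t)\<^sup>2 / 2))\<^sup>2 \<le> exp (- (\<epsilon> * t)\<^sup>2 / 2)" for t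
      by (simp add: power2_eq_square mult_left_le)
    then show "AE t in lborel. norm ((cmod (complex_of_real (exp (- (\<epsilon> * t)\<^sup>2 / 2))))\<^sup>2) \<le> norm (exp (- (\<epsilon> * t)\<^sup>2 / 2))"
      by simp
  qed measurable
qed measurable

text \<open>Parseval with a Gaussian modulated to frequency y, whose transform is a bump of width
  \<epsilon> around y. The average of Q thus equals an honest integral transform at every y,
  although Q itself is tied to q only in the weak sense.\<close>

lemma fourier_L2_gaussian_mollify:
  assumes qQ: "fourier_L2 q Q" and \<epsilon>: "\<epsilon> > 0"
  shows "(LINT u|lborel. std_normal_density u *\<^sub>R Q (y + \<epsilon> * u))
    = FT_L1 (\<lambda>t. q t * complex_of_real (exp (- (\<epsilon> * t)\<^sup>2 / 2))) y"
proof -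
  define G where "G = (\<lambda>t. complex_of_real (exp (- (\<epsilon> * t)\<^sup>2 / 2)))"
  have G: "integrable lborel G" "is_L2 G"
    using gaussian_integrable[OF \<epsilon>] is_L2_gaussian[OF \<epsilon>] by (auto simp: G_def)
  have "complex_of_real (2 * pi) * FT_L1 (\<lambda>t. q t * G t) y
     = complex_of_real (2 * pi) * (LINT t|lborel. q t * cnj (G t * exp (\<i> * complex_of_real (y * t))))"
    unfolding FT_L1_def by (simp add: G_def exp_cnj mult_ac)
  also have "\<dots> = (LINT \<omega>|lborel. Q \<omega> * cnj (FT_L1 G (\<omega> - y)))"
    using fourier_L2_parseval[OF qQ integrable_modulate[OF G(1)] is_L2_modulate[OF G(2)], of y]
    unfolding FT_L1_modulate by simp
  also have "\<dots> = \<epsilon> *\<^sub>R (LINT u|lborel. Q (y + \<epsilon> * u) * cnj (FT_L1 G (y + \<epsilon> * u - y)))"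
    using \<epsilon> by (subst lborel_integral_real_affine[of \<epsilon> _ y]) auto
  also have "(\<lambda>u. Q (y + \<epsilon> * u) * cnj (FT_L1 G (y + \<epsilon> * u - y)))
      = (\<lambda>u. (2 * pi / \<epsilon>) *\<^sub>R (std_normal_density u *\<^sub>R Q (y + \<epsilon> * u)))"
  proof
    fix u
    have "sqrt (2 * pi) / \<epsilon> * exp (- u\<^sup>2 / 2) = (2 * pi / sqrt (2 * pi)) / \<epsilon> * exp (- u\<^sup>2 / 2)"
      by (simp only: real_div_sqrt[of "2 * pi"] pi_ge_zero mult_nonneg_nonneg zero_le_numeral)
    also have "\<dots> = 2 * pi / \<epsilon> * std_normal_density u"
      unfolding std_normal_density_def by (simp add: mult.commute)
    finally have "sqrt (2 * pi) / \<epsilon> * exp (- u\<^sup>2 / 2) = 2 * pi / \<epsilon> * std_normal_density u" .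
    then have "FT_L1 G (y + \<epsilon> * u - y) = complex_of_real (2 * pi / \<epsilon> * std_normal_density u)"
      unfolding G_def FT_L1_gaussian[OF \<epsilon>] using \<epsilon> by simp
    then show "Q (y + \<epsilon> * u) * cnj (FT_L1 G (y + \<epsilon> * u - y)) = (2 * pi / \<epsilon>) *\<^sub>R (std_normal_density u *\<^sub>R Q (y + \<epsilon> * u))"
      by (simp add: scaleR_conv_of_real)
  qed
  also have "\<epsilon> *\<^sub>R (LINT u|lborel. (2 * pi / \<epsilon>) *\<^sub>R (std_normal_density u *\<^sub>R Q (y + \<epsilon> * u)))
      = complex_of_real (2 * pi) * (LINT u|lborel. std_normal_density u *\<^sub>R Q (y + \<epsilon> * u))"
    unfolding integral_scaleR_right using \<epsilon> by (simp add: scaleR_conv_of_real[of "2 * pi"])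
  finally show ?thesis by (simp add: G_def)
qed

section \<open>Autocorrelation of the spectrum\<close>

definition autocorr :: "(real \<Rightarrow> complex) \<Rightarrow> real \<Rightarrow> complex" where
  "autocorr Q x = (LINT y|lborel. Q (x + y) * cnj (Q y))"

lemma is_L2_shift: "is_L2 Q \<Longrightarrow> is_L2 (\<lambda>y. Q (x + y))"
  using is_L2_affine[of Q 1 x] by simp

lemma sqnorm_shift: "sqnorm (\<lambda>y. Q (x + y)) = sqnorm Q"
  using sqnorm_affine[of 1 Q x] by simp

lemma Cauchy_Schwarz_shift:
  assumes "is_L2 Q"
  shows "(LINT y|lborel. cmod (Q (x + y)) * cmod (Q (z + y))) \<le> sqnorm Q"
  using Cauchy_Schwarz_is_L2[OF is_L2_shift[OF assms, of x] is_L2_shift[OF assms, of z]]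
  by (simp add: sqnorm_shift sqnorm_nonneg)

lemma norm_autocorr_le:
  assumes "is_L2 Q"
  shows "cmod (autocorr Q x) \<le> sqnorm Q"
proof -
  have "cmod (autocorr Q x) \<le> (LINT y|lborel. norm (Q (x + y) * cnj (Q y)))"
    unfolding autocorr_def by (rule integral_norm_bound)
  also have "\<dots> \<le> sqnorm Q"
    using Cauchy_Schwarz_shift[OF assms, of x 0] by (simp add: norm_mult)
  finally show ?thesis .
qed

lemma measurable_autocorr [measurable]:
  assumes [measurable]: "Q \<in> borel_measurable borel"
  shows "autocorr Q \<in> borel_measurable borel"
  unfolding autocorr_def by measurable

text \<open>The mollification acts on one factor Q alone and replaces it by the transform of the
  damped signal \<open>q'\<close>. As a product of two L2 functions \<open>q'\<close> is integrable,
  which q need not be, so it may serve as the test function in Parseval.\<close>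

lemma autocorr_gaussian_mollify:
  assumes qQ: "fourier_L2 q Q" and \<epsilon>: "\<epsilon> > 0"
  shows "(LINT u|lborel. std_normal_density u *\<^sub>R autocorr Q (x - \<epsilon> * u))
    = complex_of_real (2 * pi) * FT_L1 (\<lambda>t. complex_of_real ((cmod (q t))\<^sup>2 * exp (- (\<epsilon> * t)\<^sup>2 / 2))) x"
proof -
  note q = fourier_L2_is_L2(1)[OF qQ] and Q = fourier_L2_is_L2(2)[OF qQ]
  note [measurable] = is_L2_measurable[OF q] is_L2_measurable[OF Q]
  define q' where "q' = (\<lambda>t. q t * complex_of_real (exp (- (\<epsilon> * t)\<^sup>2 / 2)))"
  have q'1: "integrable lborel q'"
    unfolding q'_def by (rule is_L2_mult_integrable[OF q is_L2_gaussian[OF \<epsilon>]])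
  have q'2: "is_L2 q'"
    unfolding q'_def
    by (rule is_L2_dominated[OF q, of _ 1]) (auto simp: norm_mult mult_left_le)
  let ?k = "\<lambda>u y. std_normal_density u *\<^sub>R (Q (x + y) * cnj (Q (y + \<epsilon> * u)))"
  have int2: "integrable lborel (\<lambda>y. Q (x + y) * cnj (Q (y + \<epsilon> * u)))" for u
  proof (rule integrable_norm_cancel)
    show "integrable lborel (\<lambda>y. norm (Q (x + y) * cnj (Q (y + \<epsilon> * u))))"
      using is_L2_norm_mult_integrable[OF is_L2_shift[OF Q, of x] is_L2_shift[OF Q, of "\<epsilon> * u"]]
      by (simp add: norm_mult add.commute[of _ "\<epsilon> * u"])
  qed measurable
  have "integrable (lborel \<Otimes>\<^sub>M lborel) (case_prod ?k)"
  proof (rule lborel_pair.Fubini_integrable)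
    show "integrable lborel (\<lambda>u. LINT y|lborel. norm (case_prod ?k (u, y)))"
    proof (rule Bochner_Integration.integrable_bound)
      show "integrable lborel (\<lambda>u. std_normal_density u * sqnorm Q)" by simp
      have "(LINT y|lborel. cmod (Q (x + y)) * cmod (Q (y + \<epsilon> * u))) \<le> sqnorm Q" for u
        using Cauchy_Schwarz_shift[OF Q, of x "\<epsilon> * u"] by (simp add: add.commute[of _ "\<epsilon> * u"])
      moreover have "(LINT y|lborel. cmod (Q (x + y)) * cmod (Q (y + \<epsilon> * u))) \<ge> 0" for u
        by (rule integral_nonneg_AE) simp
      ultimately show "AE u in lborel. norm (LINT y|lborel. norm (case_prod ?k (u, y))) \<le> norm (std_normal_density u * sqnorm Q)"
        by (auto simp: norm_mult abs_mult sqnorm_nonneg intro!: mult_left_mono)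
    qed measurable
    show "AE u in lborel. integrable lborel (\<lambda>y. case_prod ?k (u, y))"
      using int2 by simp
  qed measurable
  from lborel_pair.Fubini_integral[OF this]
  have fub: "(LINT y|lborel. (LINT u|lborel. ?k u y)) = (LINT u|lborel. (LINT y|lborel. ?k u y))" .
  have 1: "(LINT u|lborel. ?k u y) = Q (x + y) * cnj (FT_L1 q' y)" for y
  proof -
    have "(LINT u|lborel. ?k u y) = (LINT u|lborel. Q (x + y) * cnj (std_normal_density u *\<^sub>R Q (y + \<epsilon> * u)))"
      by (simp add: scaleR_conv_of_real mult_ac)
    also have "\<dots> = Q (x + y) * cnj (LINT u|lborel. std_normal_density u *\<^sub>R Q (y + \<epsilon> * u))"
      unfolding integral_mult_right_zero Bochner_Integration.integral_cnj ..
    finally show ?thesis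
      unfolding fourier_L2_gaussian_mollify[OF qQ \<epsilon>] q'_def .
  qed
  have 2: "(LINT y|lborel. ?k u y) = std_normal_density u *\<^sub>R autocorr Q (x - \<epsilon> * u)" for u
  proof -
    have "(LINT y|lborel. Q (x + y) * cnj (Q (y + \<epsilon> * u))) = autocorr Q (x - \<epsilon> * u)"
      unfolding autocorr_def by (subst lborel_integral_real_affine[of 1 _ "- \<epsilon> * u"]) (auto simp: algebra_simps)
    then show ?thesis by simp
  qed
  have "(LINT u|lborel. std_normal_density u *\<^sub>R autocorr Q (x - \<epsilon> * u)) = (LINT y|lborel. Q (x + y) * cnj (FT_L1 q' y))"
    using fub unfolding 1 2 by simp
  also have "\<dots> = complex_of_real (2 * pi) * (LINT t|lborel. q t * exp (- \<i> * complex_of_real (x * t)) * cnj (q' t))"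
    by (rule fourier_L2_parseval[OF fourier_L2_modulate[OF qQ] q'1 q'2])
  also have "(LINT t|lborel. q t * exp (- \<i> * complex_of_real (x * t)) * cnj (q' t))
      = FT_L1 (\<lambda>t. complex_of_real ((cmod (q t))\<^sup>2 * exp (- (\<epsilon> * t)\<^sup>2 / 2))) x"
    unfolding FT_L1_def q'_def
    by (rule Bochner_Integration.integral_cong) (simp_all add: complex_norm_square mult_ac del: of_real_exp of_real_power)
  finally show ?thesis .
qed

text \<open>On the time side the damping is removed by dominated convergence with majorant |q|^2. On
  the frequency side the mollification is undone by
  \<open>AE_eq_gaussian_mollification_limit\<close>, which is where "almost everywhere" comes
  in.\<close>

lemma autocorr_eq_AE:
  assumes qQ: "fourier_L2 q Q"
  shows "AE x in lborel. autocorr Q x = complex_of_real (2 * pi) * FT_L1 (\<lambda>t. complex_of_real ((cmod (q t))\<^sup>2)) x"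
proof (rule AE_eq_gaussian_mollification_limit)
  note q = fourier_L2_is_L2(1)[OF qQ] and Q = fourier_L2_is_L2(2)[OF qQ]
  note [measurable] = is_L2_measurable[OF q] is_L2_measurable[OF Q]
  show "autocorr Q \<in> borel_measurable borel" by measurable
  show "cmod (autocorr Q x) \<le> sqnorm Q" for x by (rule norm_autocorr_le[OF Q])
  let ?T = "\<lambda>n x. complex_of_real (2 * pi) * FT_L1 (\<lambda>t. complex_of_real ((cmod (q t))\<^sup>2 * exp (- (1 / real (Suc n) * t)\<^sup>2 / 2))) x"
  show "(LINT u|lborel. std_normal_density u *\<^sub>R autocorr Q (x - u / real (Suc n))) = ?T n x" for n x
    using autocorr_gaussian_mollify[OF qQ, of "1 / real (Suc n)" x] by simp
  show "(\<lambda>n. ?T n x) \<longlonglongrightarrow> complex_of_real (2 * pi) * FT_L1 (\<lambda>t. complex_of_real ((cmod (q t))\<^sup>2)) x" for x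
    unfolding FT_L1_def
  proof (intro tendsto_mult tendsto_const integral_dominated_convergence)
    show "integrable lborel (\<lambda>t. (cmod (q t))\<^sup>2)" by (rule is_L2_integrable_square[OF q])
    have "(\<lambda>n. 1 / real (Suc n)) \<longlonglongrightarrow> 0" by (rule lim_1_over_n[THEN LIMSEQ_Suc])
    then have "(\<lambda>n. complex_of_real ((cmod (q t))\<^sup>2 * exp (- (1 / real (Suc n) * t)\<^sup>2 / 2)) * exp (- \<i> * complex_of_real (x * t)))
       \<longlonglongrightarrow> complex_of_real ((cmod (q t))\<^sup>2 * exp (- (0 * t)\<^sup>2 / 2)) * exp (- \<i> * complex_of_real (x * t))" for t
      by (intro tendsto_intros) auto
    then show "AE t in lborel. (\<lambda>n. complex_of_real ((cmod (q t))\<^sup>2 * exp (- (1 / real (Suc n) * t)\<^sup>2 / 2)) * exp (- \<i> * complex_of_real (x * t)))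
       \<longlonglongrightarrow> complex_of_real ((cmod (q t))\<^sup>2) * exp (- \<i> * complex_of_real (x * t))"
      by simp
    show "AE t in lborel. norm (complex_of_real ((cmod (q t))\<^sup>2 * exp (- (1 / real (Suc n) * t)\<^sup>2 / 2)) * exp (- \<i> * complex_of_real (x * t)))
       \<le> (cmod (q t))\<^sup>2" for n
      by (simp add: norm_mult norm_power mult_left_le del: of_real_mult of_real_power of_real_exp)
  qed measurable
qed

text \<open>The opposite half of Plancherel, by duality. The truncations \<open>p n\<close> of q are
  integrable test functions; Parseval, Cauchy-Schwarz and \<open>sqnorm_FT_L1_le\<close> bound x = 2
  pi ||p n||^2 by ||Q|| sqrt x, and sqrt x cancels unless it is 0.\<close>

lemma sqnorm_fourier_L2_le:
  assumes qQ: "fourier_L2 q Q"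
  shows "2 * pi * sqnorm q \<le> sqnorm Q"
proof -
  note q = fourier_L2_is_L2(1)[OF qQ] and Q = fourier_L2_is_L2(2)[OF qQ]
  note [measurable] = is_L2_measurable[OF q] is_L2_measurable[OF Q]
  define p where "p = (\<lambda>n t. indicator {- real n..real n} t * q t)"
  have ind: "is_L2 (indicator {- real n..real n})" for n
  proof -
    have "(cmod (indicator {- real n..real n} x))\<^sup>2 = indicator {- real n..real n} x" for x
      by (simp add: indicator_def)
    then show ?thesis unfolding is_L2_def by simp
  qed
  have p1: "integrable lborel (p n)" for n
    unfolding p_def by (rule is_L2_mult_integrable[OF ind q])
  have p2: "is_L2 (p n)" for n
    unfolding p_def by (rule is_L2_dominated[OF q, of _ 1]) (auto simp: indicator_def)
  have "2 * pi * sqnorm (p n) \<le> sqnorm Q" for n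
  proof -
    define x where "x = 2 * pi * sqnorm (p n)"
    have x0: "x \<ge> 0" by (simp add: x_def sqnorm_nonneg)
    have "q t * cnj (p n t) = complex_of_real ((cmod (p n t))\<^sup>2)" for t
      unfolding complex_norm_square by (simp add: p_def indicator_def)
    then have "complex_of_real x = complex_of_real (2 * pi) * (LINT t|lborel. q t * cnj (p n t))"
      by (simp add: x_def sqnorm_def del: of_real_power)
    also have "\<dots> = (LINT \<omega>|lborel. Q \<omega> * cnj (FT_L1 (p n) \<omega>))"
      by (rule fourier_L2_parseval[OF qQ p1 p2, symmetric])
    finally have "x \<le> cmod (LINT \<omega>|lborel. Q \<omega> * cnj (FT_L1 (p n) \<omega>))"
      using norm_of_real[of x, where 'a=complex] by simp
    also have "\<dots> \<le> (LINT \<omega>|lborel. cmod (Q \<omega>) * cmod (FT_L1 (p n) \<omega>))"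
      by (rule order_trans[OF integral_norm_bound]) (simp add: norm_mult)
    also have "\<dots> \<le> sqrt (sqnorm Q) * sqrt (sqnorm (FT_L1 (p n)))"
      by (rule Cauchy_Schwarz_is_L2[OF Q is_L2_FT_L1[OF p1 p2]])
    also have "\<dots> \<le> sqrt (sqnorm Q) * sqrt x"
      unfolding x_def by (intro mult_left_mono real_sqrt_le_mono sqnorm_FT_L1_le[OF p1 p2]) (simp add: sqnorm_nonneg)
    finally have "sqrt x * sqrt x \<le> sqrt (sqnorm Q) * sqrt x" using x0 by simp
    have "sqrt x \<le> sqrt (sqnorm Q)"
    proof (cases "x = 0")
      case False
      with \<open>sqrt x * sqrt x \<le> sqrt (sqnorm Q) * sqrt x\<close> x0 show ?thesis
        by (intro mult_right_le_imp_le[of "sqrt x" "sqrt x"]) auto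
    qed (simp add: sqnorm_nonneg)
    then show ?thesis by (simp add: x_def)
  qed
  moreover have "(\<lambda>n. sqnorm (p n)) \<longlonglongrightarrow> sqnorm q"
    unfolding sqnorm_def
  proof (rule integral_dominated_convergence[OF _ _ is_L2_integrable_square[OF q]])
    have "(\<lambda>n. (cmod (p n t))\<^sup>2) \<longlonglongrightarrow> (cmod (q t))\<^sup>2" for t
    proof (rule tendsto_eventually)
      obtain m where m: "\<bar>t\<bar> < real m" using reals_Archimedean2 by blast
      show "\<forall>\<^sub>F n in sequentially. (cmod (p n t))\<^sup>2 = (cmod (q t))\<^sup>2"
        using eventually_ge_at_top[of m] by eventually_elim (use m in \<open>auto simp: p_def indicator_def\<close>)
    qed
    then show "AE t in lborel. (\<lambda>n. (cmod (p n t))\<^sup>2) \<longlonglongrightarrow> (cmod (q t))\<^sup>2" by simp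
    show "AE t in lborel. norm ((cmod (p n t))\<^sup>2) \<le> (cmod (q t))\<^sup>2" for n
      by (auto simp: p_def indicator_def)
  qed (unfold p_def, measurable)
  ultimately show ?thesis
    by (intro tendsto_upperbound[of "\<lambda>n. 2 * pi * sqnorm (p n)" _ sequentially]) (auto intro!: tendsto_intros)
qed

section \<open>The cubic term as a transform\<close>

lemma cnj_FT_L1_real:
  "cnj (FT_L1 (\<lambda>t. complex_of_real (p t)) x) = FT_L1 (\<lambda>t. complex_of_real (p t)) (- x)"
  unfolding FT_L1_def Bochner_Integration.integral_cnj[symmetric] by (simp add: exp_cnj)

lemma nl_term_eq_autocorr: "nl_term Q \<omega> = (LINT \<omega>1|lborel. Q \<omega>1 * autocorr Q (\<omega> - \<omega>1))"
  unfolding nl_term_def autocorr_def integral_mult_right_zero[symmetric] by (simp add: mult_ac)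

text \<open>The bound M puts |q|^2 into L2, so that modulations of it are test functions for
  Parseval. The autocorrelation identity is used only beneath an integral, hence the conclusion
  holds at every \<omega>.\<close>

lemma nl_term_eq:
  assumes qQ: "fourier_L2 q Q" and M: "\<And>t. cmod (q t) \<le> M"
  shows "nl_term Q \<omega> = complex_of_real (4 * pi\<^sup>2) * FT_L1 (\<lambda>t. complex_of_real ((cmod (q t))\<^sup>2) * q t) \<omega>"
proof -
  note q = fourier_L2_is_L2(1)[OF qQ] and Q = fourier_L2_is_L2(2)[OF qQ]
  note [measurable] = is_L2_measurable[OF q] is_L2_measurable[OF Q]
  define p where "p = (\<lambda>t. complex_of_real ((cmod (q t))\<^sup>2))"
  have [measurable]: "p \<in> borel_measurable borel" unfolding p_def by measurable
  have p1: "integrable lborel p"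
    unfolding p_def using is_L2_integrable_square[OF q] by (rule integrable_of_real)
  have p2: "is_L2 p"
    by (rule is_L2_dominated[OF q, of _ M])
       (use M in \<open>auto simp: p_def norm_power power2_eq_square norm_mult intro!: mult_right_mono\<close>)
  have "AE x in lborel. autocorr Q (\<omega> + (-1) * x) = complex_of_real (2 * pi) * FT_L1 p (\<omega> + (-1) * x)"
    using autocorr_eq_AE[OF qQ] unfolding p_def[symmetric]
    by (intro AE_borel_affine[where P = "\<lambda>x. autocorr Q x = complex_of_real (2 * pi) * FT_L1 p x"]) auto
  then have ae: "AE x in lborel. Q x * autocorr Q (\<omega> - x) = complex_of_real (2 * pi) * (Q x * FT_L1 p (\<omega> - x))"
    by eventually_elim simp
  have "nl_term Q \<omega> = (LINT x|lborel. complex_of_real (2 * pi) * (Q x * FT_L1 p (\<omega> - x)))"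
    unfolding nl_term_eq_autocorr by (rule integral_cong_AE[OF _ _ ae]) auto
  also have "\<dots> = complex_of_real (2 * pi) * (LINT x|lborel. Q x * FT_L1 p (\<omega> - x))"
    by (rule integral_mult_right_zero)
  \<comment> \<open>Since p is real, reflecting the argument of its transform is conjugation; the
    convolution of Q with \<open>FT_L1 p\<close> thereby takes the form of a Parseval
    pairing.\<close>
  also have "(\<lambda>x. Q x * FT_L1 p (\<omega> - x)) = (\<lambda>x. Q x * cnj (FT_L1 (\<lambda>t. p t * exp (\<i> * complex_of_real (\<omega> * t))) x))"
    unfolding FT_L1_modulate unfolding p_def cnj_FT_L1_real by simp
  also have "(LINT x|lborel. Q x * cnj (FT_L1 (\<lambda>t. p t * exp (\<i> * complex_of_real (\<omega> * t))) x))
      = complex_of_real (2 * pi) * (LINT t|lborel. q t * cnj (p t * exp (\<i> * complex_of_real (\<omega> * t))))"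
    by (rule fourier_L2_parseval[OF qQ integrable_modulate[OF p1] is_L2_modulate[OF p2]])
  also have "(LINT t|lborel. q t * cnj (p t * exp (\<i> * complex_of_real (\<omega> * t)))) = FT_L1 (\<lambda>t. p t * q t) \<omega>"
    unfolding FT_L1_def by (simp add: p_def exp_cnj mult_ac)
  finally show ?thesis by (simp add: p_def power2_eq_square)
qed

text \<open>With r = |q|^2 q, the bounds |r| \<le> M |q|^2 and |r| \<le> M^2 |q| give integrability
  and square-integrability. The factor 2 pi from \<open>sqnorm_FT_L1_le\<close> is absorbed by
  \<open>sqnorm_fourier_L2_le\<close>. The inner product is a positive multiple of the integral of
  |q|^4, hence real.\<close>

lemma
  assumes qQ: "fourier_L2 q Q" and M: "\<And>t. cmod (q t) \<le> M"
  shows is_L2_nl_term: "is_L2 (nl_term Q)"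
    and sqnorm_nl_term_le: "sqnorm (nl_term Q) \<le> (4 * pi\<^sup>2 * M\<^sup>2)\<^sup>2 * sqnorm Q"
    and nl_term_inner_real: "Im (LINT \<omega>|lborel. Q \<omega> * cnj (nl_term Q \<omega>)) = 0"
proof -
  note q = fourier_L2_is_L2(1)[OF qQ] and Q = fourier_L2_is_L2(2)[OF qQ]
  note [measurable] = is_L2_measurable[OF q] is_L2_measurable[OF Q]
  define r where "r = (\<lambda>t. complex_of_real ((cmod (q t))\<^sup>2) * q t)"
  have [measurable]: "r \<in> borel_measurable borel" unfolding r_def by measurable
  have nl: "nl_term Q = (\<lambda>\<omega>. complex_of_real (4 * pi\<^sup>2) * FT_L1 r \<omega>)"
    unfolding r_def using nl_term_eq[OF qQ M] by auto
  have M0: "M \<ge> 0" using order_trans[OF norm_ge_zero M] .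
  have r1: "integrable lborel r"
  proof (rule Bochner_Integration.integrable_bound)
    show "integrable lborel (\<lambda>t. M * (cmod (q t))\<^sup>2)" using is_L2_integrable_square[OF q] by simp
    show "AE t in lborel. norm (r t) \<le> norm (M * (cmod (q t))\<^sup>2)"
      using M M0 by (auto simp: r_def norm_mult norm_power abs_mult mult.commute[of M] intro!: mult_left_mono)
  qed measurable
  have rM: "cmod (r t) \<le> M\<^sup>2 * cmod (q t)" for t
    using power_mono[OF M, of _ 2] by (auto simp: r_def norm_mult norm_power intro!: mult_right_mono)
  have r2: "is_L2 r" by (rule is_L2_dominated[OF q _ rM]) measurable
  note FTr = is_L2_FT_L1[OF r1 r2]
  show "is_L2 (nl_term Q)"
    unfolding nl by (rule is_L2_dominated[OF FTr, of _ "4 * pi\<^sup>2"]) (auto simp: norm_mult norm_power)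
  have "sqnorm r \<le> (LINT t|lborel. (M\<^sup>2)\<^sup>2 * (cmod (q t))\<^sup>2)"
    unfolding sqnorm_def
  proof (rule integral_mono)
    show "(cmod (r t))\<^sup>2 \<le> (M\<^sup>2)\<^sup>2 * (cmod (q t))\<^sup>2" for t
      using power_mono[OF rM, of t 2] by (simp add: power_mult_distrib)
  qed (use is_L2_integrable_square[OF q] is_L2_integrable_square[OF r2] in auto)
  also have "\<dots> = (M\<^sup>2)\<^sup>2 * sqnorm q" unfolding sqnorm_def by simp
  finally have sr: "sqnorm r \<le> (M\<^sup>2)\<^sup>2 * sqnorm q" .
  have "sqnorm (nl_term Q) = (4 * pi\<^sup>2)\<^sup>2 * sqnorm (FT_L1 r)"
    unfolding nl sqnorm_def by (simp add: norm_mult norm_power power_mult_distrib)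
  also have "\<dots> \<le> (4 * pi\<^sup>2)\<^sup>2 * (2 * pi * sqnorm r)"
    by (intro mult_left_mono sqnorm_FT_L1_le[OF r1 r2]) simp
  also have "\<dots> \<le> (4 * pi\<^sup>2)\<^sup>2 * (2 * pi * ((M\<^sup>2)\<^sup>2 * sqnorm q))"
    by (intro mult_left_mono sr) simp_all
  also have "\<dots> = (4 * pi\<^sup>2 * M\<^sup>2)\<^sup>2 * (2 * pi * sqnorm q)" by (simp add: power_mult_distrib)
  also have "\<dots> \<le> (4 * pi\<^sup>2 * M\<^sup>2)\<^sup>2 * sqnorm Q"
    by (intro mult_left_mono sqnorm_fourier_L2_le[OF qQ]) simp
  finally show "sqnorm (nl_term Q) \<le> (4 * pi\<^sup>2 * M\<^sup>2)\<^sup>2 * sqnorm Q" .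
  have "(LINT \<omega>|lborel. Q \<omega> * cnj (nl_term Q \<omega>)) = (LINT \<omega>|lborel. complex_of_real (4 * pi\<^sup>2) * (Q \<omega> * cnj (FT_L1 r \<omega>)))"
    unfolding nl by (simp add: mult_ac)
  also have "\<dots> = complex_of_real (4 * pi\<^sup>2) * (LINT \<omega>|lborel. Q \<omega> * cnj (FT_L1 r \<omega>))"
    by (rule integral_mult_right_zero)
  also have "(LINT \<omega>|lborel. Q \<omega> * cnj (FT_L1 r \<omega>)) = complex_of_real (2 * pi) * (LINT t|lborel. q t * cnj (r t))"
    by (rule fourier_L2_parseval[OF qQ r1 r2])
  also have "(\<lambda>t. q t * cnj (r t)) = (\<lambda>t. complex_of_real ((cmod (q t))\<^sup>2 * (cmod (q t))\<^sup>2))"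
    unfolding r_def of_real_mult complex_norm_square by (simp add: mult_ac)
  also have "(LINT t|lborel. complex_of_real ((cmod (q t))\<^sup>2 * (cmod (q t))\<^sup>2)) = complex_of_real (LINT t|lborel. (cmod (q t))\<^sup>2 * (cmod (q t))\<^sup>2)"
    by (rule integral_complex_of_real)
  finally show "Im (LINT \<omega>|lborel. Q \<omega> * cnj (nl_term Q \<omega>)) = 0" by simp
qed

section \<open>Local boundedness and differentiation of the energy\<close>

text \<open>A Baire category argument: let \<open>F\<close> be the closed set of points near which \<open>E\<close> is unbounded.
  If \<open>F\<close> were nonempty, \<open>E\<close> would be bounded on a relatively open piece of \<open>F\<close>, and the two-sided
  estimate would propagate this bound into the gaps of \<open>F\<close>.\<close>

lemma locally_bounded_if_two_sided_estimate:
  fixes E :: "real \<Rightarrow> real" and L :: real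
  assumes nonneg: "\<And>s. E s \<ge> 0" and L: "L \<ge> 0"
    and lsc: "\<And>k. closed {s. s \<ge> 0 \<and> E s \<le> k}"
    and est: "\<And>a b B. 0 \<le> a \<Longrightarrow> a \<le> b \<Longrightarrow> (\<And>s. s \<in> {a..b} \<Longrightarrow> E s \<le> B) \<Longrightarrow>
       E b \<le> E a \<and> exp (L * a) * E a \<le> exp (L * b) * E b"
    and b: "b \<ge> 0"
  shows "\<exists>B. \<forall>s\<in>{0..b}. E s \<le> B"
proof -
  define loc where "loc = (\<lambda>p. \<exists>r>0. \<exists>B. \<forall>s\<ge>0. \<bar>s - p\<bar> < r \<longrightarrow> E s \<le> B)"
  have bdd: "\<exists>B. \<forall>s\<in>{c..d}. E s \<le> B" if "0 \<le> c" "c \<le> d" and l: "\<And>p. p \<in> {c..d} \<Longrightarrow> loc p" for c d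
  proof -
    have "\<exists>B. \<forall>s\<in>{c..d}. s \<ge> 0 \<longrightarrow> E s \<le> B"
    proof (induction rule: Bolzano[OF \<open>c \<le> d\<close>])
      case (1 x y z)
      then obtain B1 B2 where "\<forall>s\<in>{x..y}. s \<ge> 0 \<longrightarrow> E s \<le> B1" "\<forall>s\<in>{y..z}. s \<ge> 0 \<longrightarrow> E s \<le> B2" by blast
      then have "\<forall>s\<in>{x..z}. s \<ge> 0 \<longrightarrow> E s \<le> max B1 B2"
        by (metis atLeastAtMost_iff linorder_le_cases max.coboundedI1 max.coboundedI2)
      then show ?case by blast
    next
      case (2 x)
      then obtain r B where "r > 0" and B: "\<And>s. s \<ge> 0 \<Longrightarrow> \<bar>s - x\<bar> < r \<Longrightarrow> E s \<le> B"
        using l[of x] unfolding loc_def by auto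
      then show ?case
        by (intro exI[of _ r]) (auto intro!: exI[of _ B] B)
    qed
    then show ?thesis using \<open>0 \<le> c\<close> by auto
  qed
  define F where "F = {p. p \<ge> 0 \<and> \<not> loc p}"
  have "closed F"
  proof -
    have "open {p. loc p}"
      unfolding open_dist
    proof safe
      fix p assume "loc p"
      then obtain r B where r: "r > 0" and B: "\<And>s. s \<ge> 0 \<Longrightarrow> \<bar>s - p\<bar> < r \<Longrightarrow> E s \<le> B"
        unfolding loc_def by auto
      have "loc y" if "dist y p < r / 2" for y
        unfolding loc_def
      proof (intro exI conjI allI impI)
        show "r / 2 > 0" using r by simp
        fix s assume "0 \<le> s" "\<bar>s - y\<bar> < r / 2"
        then show "E s \<le> B" using that unfolding dist_real_def by (intro B) linarith+
      qed
      then show "\<exists>e>0. \<forall>y. dist y p < e \<longrightarrow> y \<in> {p. loc p}"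
        using r by (intro exI[of _ "r / 2"]) auto
    qed
    moreover have "F = {0..} - {p. loc p}" by (auto simp: F_def)
    ultimately show ?thesis by (simp add: closed_Diff)
  qed
  have "F = {}"
  proof (rule ccontr)
    assume ne: "F \<noteq> {}"
    define C where "C = (\<lambda>k::nat. {s. s \<ge> 0 \<and> E s \<le> real k})"
    \<comment> \<open>Otherwise all sets \<open>F - C k\<close>, relatively open by
      \<open>lsc\<close>, would be dense in F, and by Baire so would their intersection; but it is
      empty because E is finite at every point.\<close>
    have "\<exists>k. \<not> F \<subseteq> closure (F - C k)"
    proof (rule ccontr)
      assume "\<not> (\<exists>k. \<not> F \<subseteq> closure (F - C k))"
      then have dense: "F \<subseteq> closure (F - C k)" for k by blast
      have "F \<subseteq> closure (\<Inter> (range (\<lambda>k. F - C k)))"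
      proof (rule Baire[OF \<open>closed F\<close>])
        fix T assume "T \<in> range (\<lambda>k. F - C k)"
        then obtain k where T: "T = F - C k" by blast
        have "closed (C k)" unfolding C_def by (rule lsc)
        then have "openin (top_of_set F) (F - C k)"
          by (simp add: Diff_eq openin_open_Int open_Compl)
        then show "openin (top_of_set F) T \<and> F \<subseteq> closure T" using dense T by auto
      qed simp
      moreover have "\<Inter> (range (\<lambda>k. F - C k)) = {}"
      proof -
        have "\<exists>k. s \<notin> F - C k" for s
        proof -
          obtain k where "E s \<le> real k" using real_arch_simple by blast
          then show ?thesis by (auto simp: C_def F_def)
        qed
        then show ?thesis by blast
      qed
      ultimately show False using ne by (metis closure_empty subset_empty)
    qed
    then obtain k p where p: "p \<in> F" "p \<notin> closure (F - C k)" by blast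
    then obtain r where r: "r > 0" "\<And>s. s \<in> F - C k \<Longrightarrow> \<not> dist s p < r"
      unfolding closure_approachable by auto
    have Fk: "E s \<le> real k" if "s \<in> F" "\<bar>s - p\<bar> < r" for s
      using r(2)[of s] that by (auto simp: C_def F_def dist_real_def)
    have p0: "p \<ge> 0" using p by (simp add: F_def)
    \<comment> \<open>One constant for both sides of p: to the right E cannot rise above a value at
      most k taken on F, to the left it exceeds such a value by a factor of at most exp (L *
      p).\<close>
    have "E z \<le> exp (L * (p + r)) * real k" if z: "z \<ge> 0" "\<bar>z - p\<bar> < r" for z
    proof -
      have ge: "real k \<le> exp (L * (p + r)) * real k"
        using L p0 r by (intro mult_right_le_one_le[of "real k" "1", simplified] mult_le_cancel_right1[THEN iffD2]) auto
      consider "z \<in> F" | "z \<notin> F" "p < z" | "z \<notin> F" "z < p" using p by fastforce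
      then show ?thesis
      proof cases
        case 1
        then show ?thesis using Fk z ge by force
      next
        case 2
        define a where "a = Sup (F \<inter> {p..z})"
        have aF: "a \<in> F \<inter> {p..z}"
          unfolding a_def using p 2 \<open>closed F\<close>
          by (intro closed_contains_Sup) (auto intro!: bdd_aboveI[of _ z] closed_Int)
        have up: "s \<le> a" if "s \<in> F" "s \<in> {p..z}" for s
          unfolding a_def using that by (intro cSup_upper) (auto intro!: bdd_aboveI[of _ z])
        \<comment> \<open>The bound does not deteriorate as s approaches a. Hence E is bounded on
          the closed interval from a to z, although a lies in F, and \<open>est\<close> may be
          started at a itself.\<close>
        have gap: "E s \<le> exp (L * z) * E z" if s: "a < s" "s \<le> z" for s
        proof -
          have "loc y" if "y \<in> {s..z}" for y
            using up[of y] that s aF p0 by (force simp: F_def)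
          then obtain B where B: "\<forall>y\<in>{s..z}. E y \<le> B" using bdd[of s z] s aF p0 by auto
          have "E s \<le> exp (L * s) * E s"
            using L s aF p0 nonneg[of s] by (simp add: mult_le_cancel_right1)
          also have "\<dots> \<le> exp (L * z) * E z" using est[of s z B] B s aF p0 by auto
          finally show ?thesis .
        qed
        have "E s \<le> max (E a) (exp (L * z) * E z)" if "s \<in> {a..z}" for s
          using gap[of s] that by (cases "s = a") auto
        then have "E z \<le> E a" using est[of a z] aF p0 by auto
        also have "\<dots> \<le> real k" using Fk[of a] aF z by auto
        finally show ?thesis using ge by simp
      next
        case 3
        define a where "a = Inf (F \<inter> {z..p})"
        have aF: "a \<in> F \<inter> {z..p}"
          unfolding a_def using p 3 \<open>closed F\<close>
          by (intro closed_contains_Inf) (auto intro!: bdd_belowI[of _ z] closed_Int)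
        have low: "a \<le> s" if "s \<in> F" "s \<in> {z..p}" for s
          unfolding a_def using that by (intro cInf_lower) (auto intro!: bdd_belowI[of _ z])
        \<comment> \<open>The mirror image: here the decrease of E gives a bound uniform up to a,
          and the exponentially weighted growth carries the bound at a back to z.\<close>
        have gap: "E s \<le> E z" if s: "z \<le> s" "s < a" for s
        proof -
          have "loc y" if "y \<in> {z..s}" for y
            using low[of y] that s aF z by (force simp: F_def)
          then obtain B where B: "\<forall>y\<in>{z..s}. E y \<le> B" using bdd[of z s] s z by auto
          then show ?thesis using est[of z s B] s z by auto
        qed
        have "E s \<le> max (E a) (E z)" if "s \<in> {z..a}" for s
          using gap[of s] that by (cases "s = a") auto
        then have le: "exp (L * z) * E z \<le> exp (L * a) * E a" using est[of z a] aF z by auto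
        have "E z \<le> exp (L * z) * E z"
          using L z nonneg[of z] by (simp add: mult_le_cancel_right1)
        also note le
        also have "exp (L * a) * E a \<le> exp (L * (p + r)) * real k"
          using Fk[of a] aF z r L nonneg[of a] by (intro mult_mono) (auto intro!: mult_left_mono)
        finally show ?thesis .
      qed
    qed
    then have "loc p" unfolding loc_def using r by blast
    then show False using p by (simp add: F_def)
  qed
  then have "loc s" if "s \<ge> 0" for s using that by (auto simp: F_def)
  then show ?thesis using b by (intro bdd) auto
qed

section \<open>Joint measurability and integration of a pointwise derivative\<close>

text \<open>Rounding s down to a grid leaves countably many slices, each measurable, and continuity
  in s takes the limit. Clamping with \<open>max 0\<close> extends to the whole line a function
  controlled only on the half line.\<close>

lemma measurable_Caratheodory_function:
  fixes f :: "real \<Rightarrow> real \<Rightarrow> real"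
  assumes meas: "\<And>s. s \<ge> 0 \<Longrightarrow> f s \<in> borel_measurable borel"
    and cont: "\<And>\<omega>. continuous_on {0..} (\<lambda>s. f s \<omega>)"
  shows "(\<lambda>(s, \<omega>). f (max 0 s) \<omega>) \<in> borel_measurable (lborel \<Otimes>\<^sub>M lborel)"
proof (rule borel_measurable_LIMSEQ_metric)
  let ?g = "\<lambda>n (s::real). max 0 (real_of_int \<lfloor>real (Suc n) * s\<rfloor> / real (Suc n))"
  show "(\<lambda>(s, \<omega>). f (?g n s) \<omega>) \<in> borel_measurable (lborel \<Otimes>\<^sub>M lborel)" for n
  proof -
    have "(\<lambda>p::real \<times> real. f (max 0 (real_of_int (\<lfloor>real (Suc n) * fst p\<rfloor>) / real (Suc n))) (snd p))
       \<in> borel_measurable (lborel \<Otimes>\<^sub>M lborel)"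
    proof (rule measurable_compose_countable[where g = "\<lambda>p. \<lfloor>real (Suc n) * fst p\<rfloor>"
          and f = "\<lambda>i p. f (max 0 (real_of_int i / real (Suc n))) (snd p)"])
      fix i :: int
      have [measurable]: "f (max 0 (real_of_int i / real (Suc n))) \<in> borel_measurable borel"
        by (rule meas) simp
      show "(\<lambda>p::real \<times> real. f (max 0 (real_of_int i / real (Suc n))) (snd p)) \<in> borel_measurable (lborel \<Otimes>\<^sub>M lborel)"
        by measurable
    qed measurable
    then show ?thesis by (simp add: split_beta)
  qed
  fix p :: "real \<times> real"
  obtain s \<omega> where p: "p = (s, \<omega>)" by force
  have "(\<lambda>n. real_of_int \<lfloor>real (Suc n) * s\<rfloor> / real (Suc n)) \<longlonglongrightarrow> s"
  proof (rule real_tendsto_sandwich)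
    show "\<forall>\<^sub>F n in sequentially. s - 1 / real (Suc n) \<le> real_of_int \<lfloor>real (Suc n) * s\<rfloor> / real (Suc n)"
    proof (intro always_eventually allI)
      fix n
      have "real (Suc n) * s - 1 \<le> real_of_int \<lfloor>real (Suc n) * s\<rfloor>" by linarith
      then have "(real (Suc n) * s - 1) / real (Suc n) \<le> real_of_int \<lfloor>real (Suc n) * s\<rfloor> / real (Suc n)"
        by (rule divide_right_mono) simp
      then show "s - 1 / real (Suc n) \<le> real_of_int \<lfloor>real (Suc n) * s\<rfloor> / real (Suc n)"
        by (simp add: diff_divide_distrib del: of_nat_Suc)
    qed
    show "\<forall>\<^sub>F n in sequentially. real_of_int \<lfloor>real (Suc n) * s\<rfloor> / real (Suc n) \<le> s"
    proof (intro always_eventually allI)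
      fix n
      have "real_of_int \<lfloor>real (Suc n) * s\<rfloor> / real (Suc n) \<le> (real (Suc n) * s) / real (Suc n)"
        by (intro divide_right_mono of_int_floor_le) simp
      then show "real_of_int \<lfloor>real (Suc n) * s\<rfloor> / real (Suc n) \<le> s" by (simp del: of_nat_Suc)
    qed
    show "(\<lambda>n. s - 1 / real (Suc n)) \<longlonglongrightarrow> s"
      using tendsto_diff[OF tendsto_const lim_1_over_n[THEN LIMSEQ_Suc], of s] by simp
  qed simp
  then have "(\<lambda>n. ?g n s) \<longlonglongrightarrow> max 0 s" by (intro tendsto_max tendsto_const)
  then have "(\<lambda>n. f (?g n s) \<omega>) \<longlonglongrightarrow> f (max 0 s) \<omega>"
    by (intro continuous_on_tendsto_compose[OF cont]) auto
  then show "(\<lambda>n. case p of (s, \<omega>) \<Rightarrow> f (?g n s) \<omega>) \<longlonglongrightarrow> (case p of (s, \<omega>) \<Rightarrow> f (max 0 s) \<omega>)"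
    by (simp add: p)
qed

text \<open>The derivative is a limit of forward difference quotients, which stay inside the half
  line even at s = 0. Fubini for f' rests on this joint measurability.\<close>

lemma measurable_derivative_pair:
  fixes f f' :: "real \<Rightarrow> real \<Rightarrow> real"
  assumes meas: "\<And>s. s \<ge> 0 \<Longrightarrow> f s \<in> borel_measurable borel"
    and deriv: "\<And>s \<omega>. s \<ge> 0 \<Longrightarrow> ((\<lambda>s. f s \<omega>) has_real_derivative f' s \<omega>) (at s within {0..})"
  shows "(\<lambda>(s, \<omega>). f' (max 0 s) \<omega>) \<in> borel_measurable (lborel \<Otimes>\<^sub>M lborel)"
proof (rule borel_measurable_LIMSEQ_metric)
  have cont: "continuous_on {0..} (\<lambda>s. f s \<omega>)" for \<omega>
    using deriv by (intro DERIV_continuous_on) auto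
  have cont': "continuous_on {0..} (\<lambda>s. f (s + 1 / real (Suc n)) \<omega>)" for n \<omega>
    by (rule continuous_on_compose2[OF cont, of "{0..}" "\<lambda>s. s + 1 / real (Suc n)"]) (auto intro!: continuous_intros)
  note m1 = measurable_Caratheodory_function[of f, OF meas cont]
  note m2 = measurable_Caratheodory_function[of "\<lambda>s. f (s + 1 / real (Suc n))" for n, OF meas cont']
  show "(\<lambda>(s, \<omega>). real (Suc n) * (f (max 0 s + 1 / real (Suc n)) \<omega> - f (max 0 s) \<omega>)) \<in> borel_measurable (lborel \<Otimes>\<^sub>M lborel)" for n
    using borel_measurable_times[OF borel_measurable_const[of "real (Suc n)"] borel_measurable_diff[OF m2[of n] m1]]
    by (simp add: split_beta)
  fix p :: "real \<times> real"
  obtain s \<omega> where p: "p = (s, \<omega>)" by force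
  have "((\<lambda>y. (f y \<omega> - f (max 0 s) \<omega>) / (y - max 0 s)) \<longlongrightarrow> f' (max 0 s) \<omega>) (at (max 0 s) within {0..})"
    using deriv[of "max 0 s" \<omega>] by (simp add: has_field_derivative_iff)
  moreover have "filterlim (\<lambda>n. max 0 s + 1 / real (Suc n)) (at (max 0 s) within {0..}) sequentially"
    unfolding filterlim_at
    using tendsto_add[OF tendsto_const lim_1_over_n[THEN LIMSEQ_Suc], of "max 0 s"] by auto
  ultimately have "(\<lambda>n. (f (max 0 s + 1 / real (Suc n)) \<omega> - f (max 0 s) \<omega>) / (max 0 s + 1 / real (Suc n) - max 0 s)) \<longlonglongrightarrow> f' (max 0 s) \<omega>"
    by (rule filterlim_compose)
  then show "(\<lambda>n. case p of (s, \<omega>) \<Rightarrow> real (Suc n) * (f (max 0 s + 1 / real (Suc n)) \<omega> - f (max 0 s) \<omega>))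
      \<longlonglongrightarrow> (case p of (s, \<omega>) \<Rightarrow> f' (max 0 s) \<omega>)"
    by (simp add: p mult.commute)
qed

text \<open>Only the L1 norms of f' are bounded uniformly in s; no common majorant is given. Hence
  there is no differentiation under the integral: the fundamental theorem is applied at almost every
  \<omega>, and Fubini exchanges the integrals.\<close>

lemma
  fixes f f' :: "real \<Rightarrow> real \<Rightarrow> real"
  assumes ab: "0 \<le> a" "a \<le> b"
    and meas: "\<And>s. s \<ge> 0 \<Longrightarrow> f s \<in> borel_measurable borel"
    and deriv: "\<And>s \<omega>. s \<ge> 0 \<Longrightarrow> ((\<lambda>s. f s \<omega>) has_real_derivative f' s \<omega>) (at s within {0..})"
    and int: "integrable lborel (f a)" "integrable lborel (f b)"
    and int': "\<And>s. s \<in> {a..b} \<Longrightarrow> integrable lborel (f' s)"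
    and bound: "\<And>s. s \<in> {a..b} \<Longrightarrow> (LINT \<omega>|lborel. \<bar>f' s \<omega>\<bar>) \<le> B"
  shows set_integrable_integral_deriv: "set_integrable lborel {a..b} (\<lambda>s. LINT \<omega>|lborel. f' s \<omega>)"
    and integral_FTC_under_integral:
      "(LINT \<omega>|lborel. f b \<omega>) - (LINT \<omega>|lborel. f a \<omega>) = (LINT s:{a..b}|lborel. (LINT \<omega>|lborel. f' s \<omega>))"
proof -
  define F where "F = (\<lambda>s \<omega>. indicator {a..b} s * f' (max 0 s) \<omega>)"
  note [measurable] = measurable_derivative_pair[of f f', OF meas deriv]
  have F: "F s \<omega> = indicator {a..b} s * f' s \<omega>" for s \<omega>
    using ab by (auto simp: F_def indicator_def max_def)
  have Fm[measurable]: "case_prod F \<in> borel_measurable (lborel \<Otimes>\<^sub>M lborel)"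
    using borel_measurable_times[of "\<lambda>p. indicator {a..b} (fst p)" "lborel \<Otimes>\<^sub>M lborel" "\<lambda>(s, \<omega>). f' (max 0 s) \<omega>"]
    unfolding F_def by (simp add: split_beta)
  have Fint: "integrable (lborel \<Otimes>\<^sub>M lborel) (case_prod F)"
  proof (rule lborel_pair.Fubini_integrable)
    show "integrable lborel (\<lambda>s. LINT \<omega>|lborel. norm (case_prod F (s, \<omega>)))"
    proof (rule Bochner_Integration.integrable_bound)
      show "integrable lborel (\<lambda>s. B * indicator {a..b} s)" using ab by simp
      have "0 \<le> (LINT \<omega>|lborel. \<bar>f' s \<omega>\<bar>)" for s by (rule integral_nonneg_AE) simp
      then have "norm (LINT \<omega>|lborel. norm (case_prod F (s, \<omega>))) \<le> norm (B * indicator {a..b} s)" for s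
        using bound[of s] by (cases "s \<in> {a..b}") (simp_all add: F)
      then show "AE s in lborel. norm (LINT \<omega>|lborel. norm (case_prod F (s, \<omega>))) \<le> norm (B * indicator {a..b} s)" by simp
    qed measurable
    have "integrable lborel (\<lambda>\<omega>. case_prod F (s, \<omega>))" for s
      using int'[of s] by (cases "s \<in> {a..b}") (simp_all add: F)
    then show "AE s in lborel. integrable lborel (\<lambda>\<omega>. case_prod F (s, \<omega>))" by simp
  qed fact
  have inner: "(LINT \<omega>|lborel. F s \<omega>) = indicator {a..b} s *\<^sub>R (LINT \<omega>|lborel. f' s \<omega>)" for s
    by (simp add: F)
  show "set_integrable lborel {a..b} (\<lambda>s. LINT \<omega>|lborel. f' s \<omega>)"
    using lborel_pair.integrable_fst[OF Fint] unfolding inner set_integrable_def .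
  have "AE \<omega> in lborel. (LINT s|lborel. F s \<omega>) = f b \<omega> - f a \<omega>"
    using lborel_pair.AE_integrable_snd[OF Fint]
  proof eventually_elim
    case (elim \<omega>)
    then have si: "set_integrable lborel {a..b} (\<lambda>s. f' s \<omega>)" unfolding set_integrable_def F by simp
    \<comment> \<open>The derivative is not known to be continuous in s, which the gauge integral
      does not mind; \<open>si\<close>, supplied by Fubini for almost every \<omega>, identifies it
      with the Lebesgue integral.\<close>
    have "((\<lambda>s. f' s \<omega>) has_integral (f b \<omega> - f a \<omega>)) {a..b}"
    proof (rule fundamental_theorem_of_calculus[OF ab(2)])
      fix s assume "s \<in> {a..b}"
      then show "((\<lambda>s. f s \<omega>) has_vector_derivative f' s \<omega>) (at s within {a..b})"
        using ab DERIV_subset[OF deriv[of s \<omega>], of "{a..b}"]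
        by (auto simp: has_real_derivative_iff_has_vector_derivative[symmetric])
    qed
    then have "f b \<omega> - f a \<omega> = (LINT s:{a..b}|lborel. f' s \<omega>)"
      using set_borel_integral_eq_integral(2)[OF si] by (simp add: integral_unique)
    then show ?case unfolding set_lebesgue_integral_def F by simp
  qed
  then have "(LINT \<omega>|lborel. f b \<omega> - f a \<omega>) = (LINT \<omega>|lborel. (LINT s|lborel. F s \<omega>))"
    using int lborel_pair.integrable_snd[OF Fint] by (intro integral_cong_AE) (auto elim: AE_mp)
  also have "\<dots> = (LINT s|lborel. (LINT \<omega>|lborel. F s \<omega>))"
    by (rule lborel_pair.Fubini_integral[OF Fint])
  finally show "(LINT \<omega>|lborel. f b \<omega>) - (LINT \<omega>|lborel. f a \<omega>) = (LINT s:{a..b}|lborel. (LINT \<omega>|lborel. f' s \<omega>))"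
    using int unfolding inner set_lebesgue_integral_def by simp
qed

lemma integral_exp_Icc:
  fixes l b :: real
  assumes "l \<noteq> 0" "0 \<le> b"
  shows "(LINT s:{0..b}|lborel. exp (l * s)) = (exp (l * b) - 1) / l"
proof -
  have "(LINT s:{0..b}|lborel. exp (l * s)) = exp (l * b) / l - exp (l * 0) / l"
    unfolding set_lebesgue_integral_def
    by (rule integral_FTC_atLeastAtMost[OF assms(2)])
       (use assms in \<open>auto intro!: derivative_eq_intros continuous_intros
          simp: has_real_derivative_iff_has_vector_derivative[symmetric]\<close>)
  then show ?thesis by (simp add: diff_divide_distrib)
qed

section \<open>Energy balance\<close>

text \<open>A single finite attenuation profile. The theorem takes \<open>\<alpha>1\<close> for L;
  the final bounds \<open>en_decay\<close> and \<open>en_band_approx\<close> no longer contain L,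
  while M survives in them through \<open>K\<close>.\<close>

locale lossy_evolution =
  fixes \<alpha> :: "real \<Rightarrow> real" and \<beta>2 \<gamma> M L :: real and Q q :: "real \<Rightarrow> real \<Rightarrow> complex"
  assumes evolves: "propagates \<alpha> \<beta>2 \<gamma> Q"
    and pair: "\<And>s. s \<ge> 0 \<Longrightarrow> fourier_L2 (q s) (Q s)"
    and q_le: "\<And>s t. s \<ge> 0 \<Longrightarrow> cmod (q s t) \<le> M"
    and \<alpha>_measurable [measurable]: "\<alpha> \<in> borel_measurable borel"
    and \<alpha>_nonneg: "\<And>\<omega>. 0 \<le> \<alpha> \<omega>" and \<alpha>_le: "\<And>\<omega>. \<alpha> \<omega> \<le> L"
begin

definition en :: "real set \<Rightarrow> real \<Rightarrow> real" where
  "en S s = (LINT \<omega>|lborel. indicator S \<omega> * (cmod (Q s \<omega>))\<^sup>2)"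

text \<open>The part of the z-derivative of |Q|^2 due to the cubic term. Dispersion multiplies Q by
  an imaginary number and leaves |Q|^2 unchanged.\<close>

definition flux :: "real \<Rightarrow> real \<Rightarrow> real" where
  "flux s \<omega> = 2 * Re (cnj (Q s \<omega>) * (\<i> * complex_of_real (\<gamma> / (4 * pi\<^sup>2)) * nl_term (Q s) \<omega>))"

text \<open>The factor 2 |\<gamma>| / (4 pi^2) of \<open>abs_flux_le\<close> times the norm bound 4
  pi^2 M^2 of the cubic term.\<close>

definition K :: real where "K = 2 * \<bar>\<gamma>\<bar> * M\<^sup>2"

lemma K_nonneg: "K \<ge> 0"
  by (simp add: K_def)

lemma Q_is_L2: "s \<ge> 0 \<Longrightarrow> is_L2 (Q s)"
  using fourier_L2_is_L2(2)[OF pair] .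

lemma Q_measurable [measurable]: "s \<ge> 0 \<Longrightarrow> Q s \<in> borel_measurable borel"
  using is_L2_measurable[OF Q_is_L2] .

lemma en_UNIV: "en UNIV s = sqnorm (Q s)"
  unfolding en_def sqnorm_def by simp

lemma en_nonneg: "en S s \<ge> 0"
  unfolding en_def by (rule integral_nonneg_AE) simp

lemma en_integrable:
  assumes "s \<ge> 0" and [measurable]: "S \<in> sets borel"
  shows "integrable lborel (\<lambda>\<omega>. indicator S \<omega> * (cmod (Q s \<omega>))\<^sup>2)"
  by (rule Bochner_Integration.integrable_bound[OF is_L2_integrable_square[OF Q_is_L2[OF assms(1)]]])
     (use assms in \<open>auto simp: indicator_def\<close>)

lemma en_le_UNIV:
  assumes "s \<ge> 0" "S \<in> sets borel"
  shows "en S s \<le> en UNIV s"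
  unfolding en_def using assms by (intro integral_mono en_integrable) (auto simp: indicator_def)

lemma en_add_complement:
  assumes "s \<ge> 0" "S \<in> sets borel"
  shows "en S s + en (UNIV - S) s = en UNIV s"
proof -
  have "en S s + en (UNIV - S) s = (LINT \<omega>|lborel. indicator S \<omega> * (cmod (Q s \<omega>))\<^sup>2 + indicator (UNIV - S) \<omega> * (cmod (Q s \<omega>))\<^sup>2)"
    unfolding en_def using assms by (intro Bochner_Integration.integral_add[symmetric] en_integrable) auto
  also have "\<dots> = en UNIV s"
    unfolding en_def by (rule Bochner_Integration.integral_cong) (auto simp: indicator_def)
  finally show ?thesis .
qed

lemma has_derivative_energy_density:
  assumes "s \<ge> 0"
  shows "((\<lambda>s. (cmod (Q s \<omega>))\<^sup>2) has_real_derivative - \<alpha> \<omega> * (cmod (Q s \<omega>))\<^sup>2 + flux s \<omega>) (at s within {0..})"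
proof -
  define X where "X = \<i> * complex_of_real (\<gamma> / (4 * pi\<^sup>2)) * nl_term (Q s) \<omega>"
  define d where "d = (- complex_of_real (\<alpha> \<omega>) / 2 + \<i> * complex_of_real (\<beta>2 / 2 * \<omega>^2)) * Q s \<omega> + X"
  have Q': "((\<lambda>s. Q s \<omega>) has_vector_derivative d) (at s within {0..})"
    using evolves assms unfolding propagates_def d_def X_def by blast
  have "((\<lambda>s. (Re (Q s \<omega>))\<^sup>2 + (Im (Q s \<omega>))\<^sup>2) has_real_derivative
      2 * Re (Q s \<omega>) * Re d + 2 * Im (Q s \<omega>) * Im d) (at s within {0..})"
    by (auto intro!: derivative_eq_intros Q')
  moreover have "2 * Re (Q s \<omega>) * Re d + 2 * Im (Q s \<omega>) * Im d = - \<alpha> \<omega> * (cmod (Q s \<omega>))\<^sup>2 + flux s \<omega>"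
    unfolding flux_def X_def[symmetric] d_def cmod_power2 by (simp add: algebra_simps power2_eq_square)
  ultimately show ?thesis unfolding cmod_power2 by simp
qed

lemma flux_measurable [measurable]:
  assumes "s \<ge> 0"
  shows "flux s \<in> borel_measurable borel"
proof -
  note [measurable] = Q_measurable[OF assms] is_L2_measurable[OF is_L2_nl_term[OF pair[OF assms] q_le[OF assms]]]
  show ?thesis unfolding flux_def by measurable
qed

lemma abs_flux_le: "\<bar>flux s \<omega>\<bar> \<le> 2 * \<bar>\<gamma> / (4 * pi\<^sup>2)\<bar> * (cmod (Q s \<omega>) * cmod (nl_term (Q s) \<omega>))"
proof -
  have "\<bar>flux s \<omega>\<bar> \<le> 2 * cmod (cnj (Q s \<omega>) * (\<i> * complex_of_real (\<gamma> / (4 * pi\<^sup>2)) * nl_term (Q s) \<omega>))"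
    unfolding flux_def abs_mult by (intro mult_mono abs_Re_le_cmod) auto
  then show ?thesis by (simp add: norm_mult norm_divide norm_power mult_ac)
qed

lemma flux_integrable:
  assumes "s \<ge> 0"
  shows "integrable lborel (flux s)"
proof (rule Bochner_Integration.integrable_bound)
  show "integrable lborel (\<lambda>\<omega>. 2 * \<bar>\<gamma> / (4 * pi\<^sup>2)\<bar> * (cmod (Q s \<omega>) * cmod (nl_term (Q s) \<omega>)))"
    using is_L2_norm_mult_integrable[OF Q_is_L2 is_L2_nl_term[OF pair q_le]] assms by simp
  show "AE \<omega> in lborel. norm (flux s \<omega>) \<le> norm (2 * \<bar>\<gamma> / (4 * pi\<^sup>2)\<bar> * (cmod (Q s \<omega>) * cmod (nl_term (Q s) \<omega>)))"
    using order_trans[OF abs_flux_le abs_ge_self] by (auto simp del: abs_mult)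
qed (use assms in simp)

lemma integral_flux:
  assumes "s \<ge> 0"
  shows "(LINT \<omega>|lborel. flux s \<omega>) = 0"
proof -
  note nl = is_L2_nl_term[OF pair[OF assms] q_le[OF assms]]
  have int: "integrable lborel (\<lambda>\<omega>. Q s \<omega> * cnj (nl_term (Q s) \<omega>))"
    using is_L2_mult_integrable[OF Q_is_L2[OF assms], of "\<lambda>\<omega>. cnj (nl_term (Q s) \<omega>)"]
      is_L2_dominated[OF nl, of "\<lambda>\<omega>. cnj (nl_term (Q s) \<omega>)" 1] is_L2_measurable[OF nl] by simp
  have "flux s \<omega> = 2 * (\<gamma> / (4 * pi\<^sup>2)) * Im (Q s \<omega> * cnj (nl_term (Q s) \<omega>))" for \<omega>
    unfolding flux_def by (simp add: field_simps)
  then have "(LINT \<omega>|lborel. flux s \<omega>) = 2 * (\<gamma> / (4 * pi\<^sup>2)) * (LINT \<omega>|lborel. Im (Q s \<omega> * cnj (nl_term (Q s) \<omega>)))"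
    by (simp only: integral_mult_right_zero)
  also have "(LINT \<omega>|lborel. Im (Q s \<omega> * cnj (nl_term (Q s) \<omega>))) = 0"
    using integral_Im[OF int] nl_term_inner_real[OF pair[OF assms] q_le[OF assms]] by simp
  finally show ?thesis by simp
qed

text \<open>In Cauchy-Schwarz the cutoff to S is put on Q and the cubic term keeps its global norm,
  so the bound vanishes together with the energy in S.\<close>

lemma flux_on_le:
  assumes s: "s \<ge> 0" and [measurable]: "S \<in> sets borel"
  shows "(LINT \<omega>|lborel. \<bar>indicator S \<omega> * flux s \<omega>\<bar>) \<le> K * (sqrt (en S s) * sqrt (en UNIV s))"
proof -
  note [measurable] = Q_measurable[OF s]
  note nl = is_L2_nl_term[OF pair[OF s] q_le[OF s]]
  define c where "c = 2 * \<bar>\<gamma> / (4 * pi\<^sup>2)\<bar>"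
  define R where "R = (\<lambda>\<omega>. indicator S \<omega> * Q s \<omega>)"
  have c0: "c \<ge> 0" by (simp add: c_def)
  have R: "is_L2 R"
    by (rule is_L2_dominated[OF Q_is_L2[OF s], of _ 1]) (auto simp: R_def indicator_def)
  have enR: "sqnorm R = en S s"
    unfolding sqnorm_def en_def R_def
    by (rule Bochner_Integration.integral_cong) (auto simp: indicator_def)
  have "(LINT \<omega>|lborel. \<bar>indicator S \<omega> * flux s \<omega>\<bar>) \<le> (LINT \<omega>|lborel. c * (cmod (R \<omega>) * cmod (nl_term (Q s) \<omega>)))"
  proof (rule integral_mono)
    show "integrable lborel (\<lambda>\<omega>. \<bar>indicator S \<omega> * flux s \<omega>\<bar>)"
      by (rule Bochner_Integration.integrable_bound[OF flux_integrable[OF s]])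
         (use s in \<open>auto simp: indicator_def\<close>)
    show "integrable lborel (\<lambda>\<omega>. c * (cmod (R \<omega>) * cmod (nl_term (Q s) \<omega>)))"
      using is_L2_norm_mult_integrable[OF R nl] by simp
    show "\<bar>indicator S \<omega> * flux s \<omega>\<bar> \<le> c * (cmod (R \<omega>) * cmod (nl_term (Q s) \<omega>))" for \<omega>
      using abs_flux_le[of s \<omega>] by (auto simp: R_def c_def indicator_def)
  qed
  also have "\<dots> = c * (LINT \<omega>|lborel. cmod (R \<omega>) * cmod (nl_term (Q s) \<omega>))" by simp
  also have "\<dots> \<le> c * (sqrt (en S s) * sqrt (sqnorm (nl_term (Q s))))"
    using Cauchy_Schwarz_is_L2[OF R nl] unfolding enR by (rule mult_left_mono[OF _ c0])
  also have "sqrt (sqnorm (nl_term (Q s))) \<le> 4 * pi\<^sup>2 * M\<^sup>2 * sqrt (en UNIV s)"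
    using real_sqrt_le_mono[OF sqnorm_nl_term_le[OF pair[OF s] q_le[OF s]]]
    by (simp add: en_UNIV real_sqrt_mult)
  also have "c * (sqrt (en S s) * (4 * pi\<^sup>2 * M\<^sup>2 * sqrt (en UNIV s))) = K * (sqrt (en S s) * sqrt (en UNIV s))"
    by (simp add: c_def K_def)
  finally show ?thesis using c0 en_nonneg by (simp add: mult_left_mono)
qed

section \<open>Weighted energy identity and monotonicity of the total energy\<close>

text \<open>Formally exp (- l s) times the derivative of \<open>exp (l * s) * en S s\<close>. The
  exponent is kept free: 0 and L give the two-sided estimate, while the loss rate on S leaves just
  the flux.\<close>

definition rate :: "real set \<Rightarrow> real \<Rightarrow> real \<Rightarrow> real" where
  "rate S l s = (LINT \<omega>|lborel. indicator S \<omega> * ((l - \<alpha> \<omega>) * (cmod (Q s \<omega>))\<^sup>2 + flux s \<omega>))"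

text \<open>The bound B turns into the uniform L1 bound on \<open>f'\<close>. Until
  \<open>en_le_initial\<close> provides it for all s, the identity is available only where the
  energy is already known to be bounded, which is the form the Baire argument asks for.\<close>

lemma
  assumes ab: "0 \<le> a" "a \<le> b" and S[measurable]: "S \<in> sets borel"
    and B: "\<And>s. s \<in> {a..b} \<Longrightarrow> en UNIV s \<le> B"
  shows rate_integrable: "set_integrable lborel {a..b} (\<lambda>s. exp (l * s) * rate S l s)"
    and energy_identity: "exp (l * b) * en S b - exp (l * a) * en S a = (LINT s:{a..b}|lborel. exp (l * s) * rate S l s)"
proof -
  define f where "f = (\<lambda>s \<omega>. exp (l * s) * (indicator S \<omega> * (cmod (Q s \<omega>))\<^sup>2))"
  define f' where "f' = (\<lambda>s \<omega>. exp (l * s) * (indicator S \<omega> * ((l - \<alpha> \<omega>) * (cmod (Q s \<omega>))\<^sup>2 + flux s \<omega>)))"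
  have rate: "(LINT \<omega>|lborel. f' s \<omega>) = exp (l * s) * rate S l s" for s
    unfolding f'_def rate_def by simp
  have en: "(LINT \<omega>|lborel. f s \<omega>) = exp (l * s) * en S s" for s
    unfolding f_def en_def by simp
  have L: "L \<ge> 0" using \<alpha>_nonneg[of 0] \<alpha>_le[of 0] by simp
  have meas: "f s \<in> borel_measurable borel" if "s \<ge> 0" for s
    using Q_measurable[OF that] unfolding f_def by measurable
  have deriv: "((\<lambda>s. f s \<omega>) has_real_derivative f' s \<omega>) (at s within {0..})" if "s \<ge> 0" for s \<omega>
  proof -
    have "((\<lambda>s. exp (l * s)) has_real_derivative l * exp (l * s)) (at s within {0..})"
      by (auto intro!: derivative_eq_intros)
    from DERIV_mult[OF this DERIV_cmult[OF has_derivative_energy_density[OF that, of \<omega>], of "indicator S \<omega>"]]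
    show ?thesis unfolding f_def f'_def by (simp add: algebra_simps)
  qed
  have int: "integrable lborel (f s)" if "s \<ge> 0" for s
    unfolding f_def using en_integrable[OF that S] by simp
  define g where "g = (\<lambda>s \<omega>. exp (\<bar>l\<bar> * b) * ((\<bar>l\<bar> + L) * (cmod (Q s \<omega>))\<^sup>2 + \<bar>flux s \<omega>\<bar>))"
  have gi: "integrable lborel (g s)" if "s \<ge> 0" for s
    unfolding g_def using is_L2_integrable_square[OF Q_is_L2[OF that]] flux_integrable[OF that] by simp
  have f'g: "\<bar>f' s \<omega>\<bar> \<le> g s \<omega>" if s: "s \<in> {a..b}" for s \<omega>
  proof -
    have "l * s \<le> \<bar>l\<bar> * b"
      using s ab mult_right_mono[OF abs_ge_self[of l], of s] mult_left_mono[of s b "\<bar>l\<bar>"] by auto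
    moreover have "\<bar>(l - \<alpha> \<omega>) * (cmod (Q s \<omega>))\<^sup>2 + flux s \<omega>\<bar> \<le> (\<bar>l\<bar> + L) * (cmod (Q s \<omega>))\<^sup>2 + \<bar>flux s \<omega>\<bar>"
    proof -
      have "\<bar>l - \<alpha> \<omega>\<bar> \<le> \<bar>l\<bar> + L" using \<alpha>_nonneg[of \<omega>] \<alpha>_le[of \<omega>] by linarith
      then have "\<bar>(l - \<alpha> \<omega>) * (cmod (Q s \<omega>))\<^sup>2\<bar> \<le> (\<bar>l\<bar> + L) * (cmod (Q s \<omega>))\<^sup>2"
        unfolding abs_mult by (simp add: mult_right_mono)
      then show ?thesis using abs_triangle_ineq[of "(l - \<alpha> \<omega>) * (cmod (Q s \<omega>))\<^sup>2" "flux s \<omega>"] by linarith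
    qed
    ultimately show ?thesis
      unfolding f'_def g_def abs_mult using L
      by (intro mult_mono) (auto simp: indicator_def)
  qed
  have int': "integrable lborel (f' s)" if s: "s \<in> {a..b}" for s
  proof (rule Bochner_Integration.integrable_bound)
    have s0: "s \<ge> 0" using s ab by simp
    show "integrable lborel (g s)" using gi[OF s0] .
    show "f' s \<in> borel_measurable lborel"
      using Q_measurable[OF s0] flux_measurable[OF s0] unfolding f'_def by measurable
    show "AE \<omega> in lborel. norm (f' s \<omega>) \<le> norm (g s \<omega>)"
      using order_trans[OF f'g[OF s] abs_ge_self] by simp
  qed
  have bound: "(LINT \<omega>|lborel. \<bar>f' s \<omega>\<bar>) \<le> exp (\<bar>l\<bar> * b) * ((\<bar>l\<bar> + L) * B + K * B)" if s: "s \<in> {a..b}" for s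
  proof -
    have s0: "s \<ge> 0" using s ab by simp
    have "(LINT \<omega>|lborel. \<bar>f' s \<omega>\<bar>) \<le> (LINT \<omega>|lborel. g s \<omega>)"
      using f'g[OF s] int'[OF s] gi[OF s0] by (intro integral_mono) auto
    also have "\<dots> = exp (\<bar>l\<bar> * b) * ((\<bar>l\<bar> + L) * en UNIV s + (LINT \<omega>|lborel. \<bar>indicator UNIV \<omega> * flux s \<omega>\<bar>))"
      unfolding g_def en_def
      using is_L2_integrable_square[OF Q_is_L2[OF s0]] flux_integrable[OF s0] by simp
    also have "\<dots> \<le> exp (\<bar>l\<bar> * b) * ((\<bar>l\<bar> + L) * B + K * B)"
    proof -
      have "(LINT \<omega>|lborel. \<bar>indicator UNIV \<omega> * flux s \<omega>\<bar>) \<le> K * B"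
        using flux_on_le[OF s0, of UNIV] mult_left_mono[OF B[OF s] K_nonneg] en_nonneg[of UNIV s] by simp
      then show ?thesis using B[OF s] L by (intro mult_left_mono add_mono) auto
    qed
    finally show ?thesis .
  qed
  note a0 = ab(1) and b0 = order_trans[OF ab]
  show "set_integrable lborel {a..b} (\<lambda>s. exp (l * s) * rate S l s)"
    using set_integrable_integral_deriv[of a b f f', OF ab meas deriv int[OF a0] int[OF b0] int' bound] unfolding rate .
  show "exp (l * b) * en S b - exp (l * a) * en S a = (LINT s:{a..b}|lborel. exp (l * s) * rate S l s)"
    using integral_FTC_under_integral[of a b f f', OF ab meas deriv int[OF a0] int[OF b0] int' bound] unfolding rate en .
qed

lemma loss_integrable:
  assumes s: "s \<ge> 0"
  shows "integrable lborel (\<lambda>\<omega>. (l - \<alpha> \<omega>) * (cmod (Q s \<omega>))\<^sup>2)"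
proof (rule Bochner_Integration.integrable_bound)
  note [measurable] = Q_measurable[OF s]
  show "integrable lborel (\<lambda>\<omega>. (\<bar>l\<bar> + L) * (cmod (Q s \<omega>))\<^sup>2)"
    using is_L2_integrable_square[OF Q_is_L2[OF s]] by simp
  show "(\<lambda>\<omega>. (l - \<alpha> \<omega>) * (cmod (Q s \<omega>))\<^sup>2) \<in> borel_measurable lborel" by measurable
  have "\<bar>l - \<alpha> \<omega>\<bar> \<le> \<bar>\<bar>l\<bar> + L\<bar>" for \<omega> using \<alpha>_nonneg[of \<omega>] \<alpha>_le[of \<omega>] by linarith
  then show "AE \<omega> in lborel. norm ((l - \<alpha> \<omega>) * (cmod (Q s \<omega>))\<^sup>2) \<le> norm ((\<bar>l\<bar> + L) * (cmod (Q s \<omega>))\<^sup>2)"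
    unfolding norm_mult by (intro AE_I2 mult_right_mono) auto
qed

lemma rate_UNIV:
  assumes "s \<ge> 0"
  shows "rate UNIV l s = (LINT \<omega>|lborel. (l - \<alpha> \<omega>) * (cmod (Q s \<omega>))\<^sup>2)"
  unfolding rate_def using loss_integrable[OF assms] flux_integrable[OF assms] integral_flux[OF assms] by simp

lemma rate_constant_loss:
  assumes "\<And>\<omega>. \<omega> \<in> S \<Longrightarrow> \<alpha> \<omega> = l"
  shows "rate S l s = (LINT \<omega>|lborel. indicator S \<omega> * flux s \<omega>)"
  unfolding rate_def using assms by (intro Bochner_Integration.integral_cong) (auto simp: indicator_def)

text \<open>The flux has total integral 0, so the sign of l - \<alpha> decides: it is nonpositive
  for l = 0 and nonnegative for l = L.\<close>

lemma en_two_sided_estimate: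
  assumes ab: "0 \<le> a" "a \<le> b" and B: "\<And>s. s \<in> {a..b} \<Longrightarrow> en UNIV s \<le> B"
  shows "en UNIV b \<le> en UNIV a \<and> exp (L * a) * en UNIV a \<le> exp (L * b) * en UNIV b"
proof
  have "rate UNIV 0 s \<le> 0" if "s \<in> {a..b}" for s
  proof -
    have "0 \<le> (LINT \<omega>|lborel. - ((0 - \<alpha> \<omega>) * (cmod (Q s \<omega>))\<^sup>2))"
      using \<alpha>_nonneg by (intro integral_nonneg_AE) simp
    then show ?thesis using that ab by (subst rate_UNIV) auto
  qed
  then have "0 \<le> (LINT s:{a..b}|lborel. - (exp (0 * s) * rate UNIV 0 s))"
    unfolding set_lebesgue_integral_def by (intro integral_nonneg_AE) (auto simp: indicator_def)
  then have "(LINT s:{a..b}|lborel. exp (0 * s) * rate UNIV 0 s) \<le> 0"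
    unfolding set_lebesgue_integral_def by simp
  then show "en UNIV b \<le> en UNIV a"
    using energy_identity[OF ab _ B, of UNIV 0] by simp
  have "rate UNIV L s \<ge> 0" if "s \<in> {a..b}" for s
    using that ab \<alpha>_le by (subst rate_UNIV) (auto intro!: integral_nonneg_AE)
  then have "0 \<le> (LINT s:{a..b}|lborel. exp (L * s) * rate UNIV L s)"
    unfolding set_lebesgue_integral_def by (intro integral_nonneg_AE) (auto simp: indicator_def)
  then show "exp (L * a) * en UNIV a \<le> exp (L * b) * en UNIV b"
    using energy_identity[OF ab _ B, of UNIV L] by simp
qed

text \<open>For fixed \<omega> the density is continuous in s; Fatou turns this into lower
  semicontinuity of the energy.\<close>

lemma en_sublevel_closed: "closed {s. s \<ge> 0 \<and> en UNIV s \<le> k}"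
  unfolding closed_sequential_limits
proof (intro allI impI)
  fix x s assume "(\<forall>n. x n \<in> {s. 0 \<le> s \<and> en UNIV s \<le> k}) \<and> x \<longlonglongrightarrow> s"
  then have x: "\<And>n. 0 \<le> x n" "\<And>n. en UNIV (x n) \<le> k" "x \<longlonglongrightarrow> s" by auto
  have s: "0 \<le> s" by (rule LIMSEQ_le_const[OF x(3)]) (use x in auto)
  have nn: "(\<integral>\<^sup>+ \<omega>. ennreal ((cmod (Q s \<omega>))\<^sup>2) \<partial>lborel) = ennreal (en UNIV s)" if "s \<ge> 0" for s
    unfolding en_UNIV sqnorm_def using is_L2_integrable_square[OF Q_is_L2[OF that]]
    by (intro nn_integral_eq_integral) auto
  have meas: "(\<lambda>\<omega>. ennreal ((cmod (Q s \<omega>))\<^sup>2)) \<in> borel_measurable lborel" if "s \<ge> 0" for s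
    using that by measurable
  have cont: "continuous_on {0..} (\<lambda>s. (cmod (Q s \<omega>))\<^sup>2)" for \<omega>
    using has_derivative_energy_density by (intro DERIV_continuous_on) auto
  have lim: "(\<lambda>n. ennreal ((cmod (Q (x n) \<omega>))\<^sup>2)) \<longlonglongrightarrow> ennreal ((cmod (Q s \<omega>))\<^sup>2)" for \<omega>
    by (intro tendsto_ennrealI continuous_on_tendsto_compose[OF cont x(3)]) (use x s in auto)
  have "ennreal (en UNIV s) = (\<integral>\<^sup>+ \<omega>. liminf (\<lambda>n. ennreal ((cmod (Q (x n) \<omega>))\<^sup>2)) \<partial>lborel)"
    unfolding nn[OF s, symmetric]
    by (intro nn_integral_cong) (use lim_imp_Liminf[OF _ lim] in simp)
  also have "\<dots> \<le> liminf (\<lambda>n. \<integral>\<^sup>+ \<omega>. ennreal ((cmod (Q (x n) \<omega>))\<^sup>2) \<partial>lborel)"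
    by (intro nn_integral_liminf meas x(1))
  also have "\<dots> \<le> liminf (\<lambda>n. ennreal k)"
    unfolding nn[OF x(1)] using x(2) by (intro Liminf_mono always_eventually allI ennreal_leI)
  also have "\<dots> = ennreal k" by (rule Liminf_const) simp
  \<comment> \<open>Comparing in \<open>ennreal\<close> is faithful only for k \<ge> 0, which any
    member of the sequence witnesses.\<close>
  finally have "en UNIV s \<le> k"
    using order_trans[OF en_nonneg[of UNIV "x 0"] x(2)] by simp
  then show "s \<in> {s. 0 \<le> s \<and> en UNIV s \<le> k}" using s by simp
qed

lemma en_le_initial:
  assumes "s \<ge> 0"
  shows "en UNIV s \<le> en UNIV 0"
proof -
  have "L \<ge> 0" using \<alpha>_nonneg[of 0] \<alpha>_le[of 0] by simp
  then have "\<exists>B. \<forall>y\<in>{0..s}. en UNIV y \<le> B"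
    by (rule locally_bounded_if_two_sided_estimate[OF en_nonneg _ en_sublevel_closed _ assms])
       (rule en_two_sided_estimate)
  then obtain B where "\<forall>y\<in>{0..s}. en UNIV y \<le> B" by blast
  then show ?thesis using en_two_sided_estimate[of 0 s B] assms by simp
qed

lemma energy_identity_from_0:
  assumes "b \<ge> 0" "S \<in> sets borel"
  shows "exp (l * b) * en S b - en S 0 = (LINT s:{0..b}|lborel. exp (l * s) * rate S l s)"
  using energy_identity[of 0 b S "en UNIV 0" l] assms en_le_initial by simp

lemma rate_integrable_from_0:
  assumes "b \<ge> 0" "S \<in> sets borel"
  shows "set_integrable lborel {0..b} (\<lambda>s. exp (l * s) * rate S l s)"
  using rate_integrable[of 0 b S "en UNIV 0" l] assms en_le_initial by simp

section \<open>Out-of-band decay and in-band approximation\<close>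

lemma abs_flux_integral_le:
  assumes s: "s \<ge> 0" and [measurable]: "S \<in> sets borel"
  shows "\<bar>LINT \<omega>|lborel. indicator S \<omega> * flux s \<omega>\<bar> \<le> K * (sqrt (en S s) * sqrt (en UNIV 0))"
proof -
  have "\<bar>LINT \<omega>|lborel. indicator S \<omega> * flux s \<omega>\<bar> \<le> (LINT \<omega>|lborel. \<bar>indicator S \<omega> * flux s \<omega>\<bar>)"
    by (rule integral_abs_bound)
  also have "\<dots> \<le> K * (sqrt (en S s) * sqrt (en UNIV s))" by (rule flux_on_le[OF assms])
  also have "\<dots> \<le> K * (sqrt (en S s) * sqrt (en UNIV 0))"
    using K_nonneg en_nonneg en_le_initial[OF s] by (intro mult_left_mono real_sqrt_le_mono) auto
  finally show ?thesis .
qed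

lemma abs_flux_integral_le':
  assumes s: "s \<ge> 0" and S: "S \<in> sets borel"
  shows "\<bar>LINT \<omega>|lborel. indicator S \<omega> * flux s \<omega>\<bar> \<le> K * en UNIV 0"
proof -
  note abs_flux_integral_le[OF assms]
  also have "K * (sqrt (en S s) * sqrt (en UNIV 0)) \<le> K * (sqrt (en UNIV 0) * sqrt (en UNIV 0))"
    using order_trans[OF en_le_UNIV[OF assms] en_le_initial[OF s]]
    by (intro mult_left_mono mult_right_mono real_sqrt_le_mono K_nonneg) (auto simp: en_nonneg)
  finally show ?thesis by (simp add: en_nonneg)
qed

text \<open>The integrating factor exp (l s) cancels the loss on S. The flux is bounded crudely by
  \<open>K * en UNIV 0\<close>, ignoring that the energy in S is small; the resulting order 1 / l
  suffices even after the square root taken in \<open>en_band_approx\<close>.\<close>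

lemma en_decay:
  assumes S: "S \<in> sets borel" and \<alpha>: "\<And>\<omega>. \<omega> \<in> S \<Longrightarrow> \<alpha> \<omega> = l" and l: "l > 0" and b: "b \<ge> 0"
  shows "en S b \<le> en UNIV 0 * (exp (- l * b) + K / l)"
proof -
  define e where "e = en UNIV 0"
  have e0: "e \<ge> 0" by (simp add: e_def en_nonneg)
  have exp_int: "set_integrable lborel {0..b} (\<lambda>s. exp (l * s) * (K * e))"
    by (intro borel_integrable_atLeastAtMost' continuous_intros)
  have "exp (l * b) * en S b - en S 0 \<le> (LINT s:{0..b}|lborel. exp (l * s) * (K * e))"
    unfolding energy_identity_from_0[OF b S]
  proof (rule set_integral_mono[OF rate_integrable_from_0[OF b S] exp_int])
    fix s assume "s \<in> {0..b}"
    then show "exp (l * s) * rate S l s \<le> exp (l * s) * (K * e)"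
      using abs_flux_integral_le'[of s S] S rate_constant_loss[of S l s] \<alpha>
      by (intro mult_left_mono) (auto simp: e_def)
  qed
  also have "\<dots> = (exp (l * b) - 1) / l * (K * e)"
    using integral_exp_Icc[of l b] l b by simp
  also have "\<dots> \<le> exp (l * b) / l * (K * e)"
    using l K_nonneg e0 by (intro mult_right_mono divide_right_mono) auto
  finally have "exp (l * b) * en S b \<le> e + exp (l * b) / l * (K * e)"
    using en_le_UNIV[of 0 S] S by (simp add: e_def)
  then have "exp (- (l * b)) * (exp (l * b) * en S b) \<le> exp (- (l * b)) * (e + exp (l * b) / l * (K * e))"
    by (rule mult_left_mono) simp
  then show ?thesis
    by (simp add: e_def exp_minus field_simps)
qed

text \<open>The flux into S is minus the flux into its complement, and the latter carries the square
  root of the complement's energy. Splitting that root as exp (- l s / 2) + sqrt (K / l) makes it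
  integrable over z: the first part gives at most 2 / l, the second b sqrt (K / l).\<close>

lemma en_band_approx:
  assumes S: "S \<in> sets borel" and \<alpha>S: "\<And>\<omega>. \<omega> \<in> S \<Longrightarrow> \<alpha> \<omega> = l0" and l0: "l0 \<ge> 0"
    and \<alpha>T: "\<And>\<omega>. \<omega> \<in> UNIV - S \<Longrightarrow> \<alpha> \<omega> = l" and l: "l > 0" and b: "b \<ge> 0"
  shows "\<bar>exp (l0 * b) * en S b - en S 0\<bar> \<le> exp (l0 * b) * (K * en UNIV 0 * (2 / l + b * sqrt (K / l)))"
proof -
  define e where "e = en UNIV 0"
  have e0: "e \<ge> 0" by (simp add: e_def en_nonneg)
  have T: "UNIV - S \<in> sets borel" using S by auto
  define \<phi> where "\<phi> = (\<lambda>s. exp (l0 * b) * (K * e * (exp (- (l / 2) * s) + sqrt (K / l))))"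
  have rate: "\<bar>rate S l0 s\<bar> \<le> K * e * (exp (- (l / 2) * s) + sqrt (K / l))" if s: "s \<ge> 0" for s
  proof -
    have "(LINT \<omega>|lborel. indicator S \<omega> * flux s \<omega>) + (LINT \<omega>|lborel. indicator (UNIV - S) \<omega> * flux s \<omega>)
       = (LINT \<omega>|lborel. indicator S \<omega> * flux s \<omega> + indicator (UNIV - S) \<omega> * flux s \<omega>)"
      using S T by (intro Bochner_Integration.integral_add[symmetric] integrable_real_mult_indicator[unfolded mult.commute[of _ "indicator _ _"]] flux_integrable[OF s]) auto
    also have "\<dots> = (LINT \<omega>|lborel. flux s \<omega>)"
      by (rule Bochner_Integration.integral_cong) (auto simp: indicator_def)
    finally have "\<bar>rate S l0 s\<bar> = \<bar>LINT \<omega>|lborel. indicator (UNIV - S) \<omega> * flux s \<omega>\<bar>"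
      using integral_flux[OF s] rate_constant_loss[of S l0 s] \<alpha>S by simp
    also have "\<dots> \<le> K * (sqrt (en (UNIV - S) s) * sqrt e)"
      unfolding e_def by (rule abs_flux_integral_le[OF s T])
    also have "\<dots> \<le> K * (sqrt (e * (exp (- l * s) + K / l)) * sqrt e)"
      using en_decay[of "UNIV - S" l s] T \<alpha>T l s K_nonneg e0
      by (intro mult_left_mono mult_right_mono real_sqrt_le_mono) (auto simp: e_def)
    also have "\<dots> = K * e * sqrt (exp (- l * s) + K / l)"
      using e0 by (simp add: real_sqrt_mult mult_ac)
    also have "\<dots> \<le> K * e * (sqrt (exp (- l * s)) + sqrt (K / l))"
      using K_nonneg e0 l by (intro mult_left_mono sqrt_add_le_add_sqrt) auto
    also have "sqrt (exp (- l * s)) = exp (- (l / 2) * s)"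
      by (rule real_sqrt_unique) (simp_all add: power2_eq_square exp_add[symmetric])
    finally show ?thesis .
  qed
  have \<phi>_int: "set_integrable lborel {0..b} \<phi>"
    unfolding \<phi>_def by (intro borel_integrable_atLeastAtMost' continuous_intros)
  have "\<bar>exp (l0 * b) * en S b - en S 0\<bar> \<le> (LINT s:{0..b}|lborel. \<bar>exp (l0 * s) * rate S l0 s\<bar>)"
    unfolding energy_identity_from_0[OF b S] set_lebesgue_integral_def
    by (rule order_trans[OF integral_abs_bound]) (simp add: abs_mult)
  also have "\<dots> \<le> (LINT s:{0..b}|lborel. \<phi> s)"
  proof (rule set_integral_mono)
    show "set_integrable lborel {0..b} (\<lambda>s. \<bar>exp (l0 * s) * rate S l0 s\<bar>)"
      using set_integrable_abs[OF rate_integrable_from_0[OF b S, of l0]] .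
    show "\<bar>exp (l0 * s) * rate S l0 s\<bar> \<le> \<phi> s" if "s \<in> {0..b}" for s
      unfolding \<phi>_def abs_mult using that rate[of s] l0
      by (intro mult_mono) (auto intro!: mult_left_mono)
  qed fact
  also have "\<dots> = exp (l0 * b) * (K * e * ((LINT s:{0..b}|lborel. exp (- (l / 2) * s)) + (LINT s:{0..b}|lborel. sqrt (K / l))))"
  proof -
    have "(LINT s:{0..b}|lborel. exp (- (l / 2) * s) + sqrt (K / l))
        = (LINT s:{0..b}|lborel. exp (- (l / 2) * s)) + (LINT s:{0..b}|lborel. sqrt (K / l))"
      by (intro set_integral_add borel_integrable_atLeastAtMost' continuous_intros)
    then show ?thesis unfolding \<phi>_def by simp
  qed
  also have "(LINT s:{0..b}|lborel. sqrt (K / l)) = b * sqrt (K / l)"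
    using b by (simp add: set_lebesgue_integral_def)
  also have "(LINT s:{0..b}|lborel. exp (- (l / 2) * s)) = (1 - exp (- (l / 2) * b)) * (2 / l)"
    using integral_exp_Icc[of "- (l / 2)" b] l b by (simp add: field_simps)
  also have "exp (l0 * b) * (K * e * ((1 - exp (- (l / 2) * b)) * (2 / l) + b * sqrt (K / l)))
      \<le> exp (l0 * b) * (K * e * (2 / l + b * sqrt (K / l)))"
    using l K_nonneg e0 by (intro mult_left_mono add_right_mono) (auto simp: field_simps)
  finally show ?thesis unfolding e_def .
qed

lemma energy_on_eq: "energy_on (Q s) S = en S s / (2 * pi)"
  unfolding energy_on_def en_def set_lebesgue_integral_def by simp

end

section \<open>The limit of infinite attenuation\<close>

lemma bands_borel [measurable]: "bands N c w \<in> sets borel"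
proof -
  have "band a b \<in> sets borel" for a b
    unfolding band_def by measurable
  then show ?thesis unfolding bands_def by (intro sets.finite_UN) auto
qed

text \<open>Infinite attenuation is a limit over a family of solutions with common initial spectrum
  and common amplitude bound, which keep the constants \<open>e\<close> and \<open>k\<close>
  independent of \<open>\<alpha>1\<close>. The limit is taken of the energies; nothing is claimed
  about convergence of the signals.\<close>

theorem theorem1:
  fixes N :: nat and c w :: "nat \<Rightarrow> real"
    and \<alpha>0 \<beta>2 \<gamma> qmax :: real
    and Q0 :: "real \<Rightarrow> complex"
    and Qs :: "real \<Rightarrow> real \<Rightarrow> real \<Rightarrow> complex"
    and qs :: "real \<Rightarrow> real \<Rightarrow> real \<Rightarrow> complex"
  assumes disj: "\<forall>m\<in>{1..N}. \<forall>n\<in>{1..N}. m \<noteq> n \<longrightarrow> band (c m) (w m) \<inter> band (c n) (w n) = {}"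
    and a0: "\<alpha>0 \<ge> 0"
    and sol: "\<forall>\<^sub>F \<alpha>1 in at_top.
       Qs \<alpha>1 0 = Q0
       \<and> propagates (brickwall \<alpha>0 \<alpha>1 (bands N c w)) \<beta>2 \<gamma> (Qs \<alpha>1)
       \<and> (\<forall>z\<ge>0. fourier_L2 (qs \<alpha>1 z) (Qs \<alpha>1 z))
       \<and> (\<forall>z\<ge>0. \<forall>t. cmod (qs \<alpha>1 z t) \<le> qmax)"
    and z: "z > 0"
  shows "((\<lambda>\<alpha>1. energy_on (Qs \<alpha>1 z) (UNIV - bands N c w)) \<longlongrightarrow> 0) at_top
       \<and> ((\<lambda>\<alpha>1. energy_on (Qs \<alpha>1 z) UNIV)
            \<longlongrightarrow> energy_on Q0 (bands N c w) * exp (- \<alpha>0 * z)) at_top"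
proof -
  define W where "W = bands N c w"
  have W: "W \<in> sets borel" unfolding W_def by measurable
  define k where "k = 2 * \<bar>\<gamma>\<bar> * qmax\<^sup>2"
  define e where "e = energy_on Q0 UNIV"
  let ?out = "\<lambda>\<alpha>1. energy_on (Qs \<alpha>1 z) (UNIV - W)"
  let ?in = "\<lambda>\<alpha>1. energy_on (Qs \<alpha>1 z) W"
  let ?d = "\<lambda>\<alpha>1. exp (\<alpha>0 * z) * (k * e * (2 / \<alpha>1 + z * sqrt (k / \<alpha>1)))"
  have ev: "\<forall>\<^sub>F \<alpha>1 in at_top. 0 \<le> ?out \<alpha>1 \<and> ?out \<alpha>1 \<le> e * (exp (- \<alpha>1 * z) + k / \<alpha>1)
      \<and> \<bar>exp (\<alpha>0 * z) * ?in \<alpha>1 - energy_on Q0 W\<bar> \<le> ?d \<alpha>1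
      \<and> energy_on (Qs \<alpha>1 z) UNIV = ?in \<alpha>1 + ?out \<alpha>1"
    \<comment> \<open>From \<open>\<alpha>0\<close> on, \<open>\<alpha>1\<close> bounds the whole
      profile and can serve as L; positivity makes it a genuine decay rate.\<close>
    using sol eventually_ge_at_top[of \<alpha>0] eventually_gt_at_top[of 0]
  proof eventually_elim
    case (elim \<alpha>1)
    define \<alpha> where "\<alpha> = brickwall \<alpha>0 \<alpha>1 W"
    have \<alpha>m: "\<alpha> \<in> borel_measurable borel"
      unfolding \<alpha>_def brickwall_def using W by (intro measurable_If_set) auto
    interpret lossy_evolution \<alpha> \<beta>2 \<gamma> qmax \<alpha>1 "Qs \<alpha>1" "qs \<alpha>1"
      by standard (use elim a0 \<alpha>m in \<open>auto simp: \<alpha>_def W_def brickwall_def\<close>)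
    have K: "K = k"
      unfolding K_def k_def ..
    have e: "e = en UNIV 0 / (2 * pi)" and Q0: "energy_on Q0 W = en W 0 / (2 * pi)"
      unfolding e_def energy_on_eq[symmetric] using elim by auto
    have T: "UNIV - W \<in> sets borel" using W by auto
    have "en (UNIV - W) z \<le> en UNIV 0 * (exp (- \<alpha>1 * z) + K / \<alpha>1)"
      by (rule en_decay[OF T]) (use elim z in \<open>auto simp: \<alpha>_def brickwall_def\<close>)
    then have "?out \<alpha>1 \<le> en UNIV 0 * (exp (- \<alpha>1 * z) + K / \<alpha>1) / (2 * pi)"
      unfolding energy_on_eq by (rule divide_right_mono) simp
    then have 1: "?out \<alpha>1 \<le> e * (exp (- \<alpha>1 * z) + k / \<alpha>1)"
      unfolding e K by simp
    have "\<bar>exp (\<alpha>0 * z) * en W z - en W 0\<bar>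
        \<le> exp (\<alpha>0 * z) * (K * en UNIV 0 * (2 / \<alpha>1 + z * sqrt (K / \<alpha>1)))"
      by (rule en_band_approx[OF W]) (use elim z a0 in \<open>auto simp: \<alpha>_def brickwall_def\<close>)
    then have "\<bar>exp (\<alpha>0 * z) * en W z - en W 0\<bar> / (2 * pi)
        \<le> exp (\<alpha>0 * z) * (K * en UNIV 0 * (2 / \<alpha>1 + z * sqrt (K / \<alpha>1))) / (2 * pi)"
      by (rule divide_right_mono) simp
    moreover have "exp (\<alpha>0 * z) * ?in \<alpha>1 - energy_on Q0 W = (exp (\<alpha>0 * z) * en W z - en W 0) / (2 * pi)"
      unfolding energy_on_eq Q0 by (simp add: diff_divide_distrib)
    ultimately have 2: "\<bar>exp (\<alpha>0 * z) * ?in \<alpha>1 - energy_on Q0 W\<bar> \<le> ?d \<alpha>1"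
      unfolding e K by (simp add: abs_divide)
    have "energy_on (Qs \<alpha>1 z) UNIV = ?in \<alpha>1 + ?out \<alpha>1"
      unfolding energy_on_eq using en_add_complement[OF _ W, of z] z by (simp add: add_divide_distrib[symmetric])
    then show ?case
      using 1 2 en_nonneg by (simp add: energy_on_eq)
  qed
  have inv: "((\<lambda>\<alpha>1. r / \<alpha>1) \<longlongrightarrow> 0) at_top" for r :: real
    by (rule real_tendsto_divide_at_top[OF tendsto_const filterlim_ident])
  have "filterlim (\<lambda>\<alpha>1. - \<alpha>1 * z) at_bot at_top"
    using filterlim_tendsto_pos_mult_at_top[OF tendsto_const z filterlim_ident]
    by (simp add: filterlim_uminus_at_top mult.commute)
  then have expz: "((\<lambda>\<alpha>1. exp (- \<alpha>1 * z)) \<longlongrightarrow> 0) at_top"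
    by (rule filterlim_compose[OF exp_at_bot])
  have "((\<lambda>\<alpha>1. e * (exp (- \<alpha>1 * z) + k / \<alpha>1)) \<longlongrightarrow> e * (0 + 0)) at_top"
    by (intro tendsto_mult tendsto_add tendsto_const inv expz)
  then have out: "(?out \<longlongrightarrow> 0) at_top"
    using ev by (intro tendsto_sandwich[of "\<lambda>_. 0" ?out at_top "\<lambda>\<alpha>1. e * (exp (- \<alpha>1 * z) + k / \<alpha>1)"])
      (auto elim: eventually_mono)
  have d: "(?d \<longlongrightarrow> exp (\<alpha>0 * z) * (k * e * (0 + z * sqrt 0))) at_top"
    by (intro tendsto_mult tendsto_add tendsto_const tendsto_real_sqrt inv)
  have "\<forall>\<^sub>F \<alpha>1 in at_top. norm (exp (\<alpha>0 * z) * ?in \<alpha>1 - energy_on Q0 W) \<le> ?d \<alpha>1"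
    using ev by eventually_elim simp
  from Lim_null_comparison[OF this] d
  have "((\<lambda>\<alpha>1. exp (\<alpha>0 * z) * ?in \<alpha>1 - energy_on Q0 W) \<longlongrightarrow> 0) at_top"
    by simp
  \<comment> \<open>The in-band energy is rebuilt from its rescaled deviation from the initial
    value, then the vanishing out-of-band part is added.\<close>
  then have "((\<lambda>\<alpha>1. exp (- \<alpha>0 * z) * ((exp (\<alpha>0 * z) * ?in \<alpha>1 - energy_on Q0 W) + energy_on Q0 W) + ?out \<alpha>1)
      \<longlongrightarrow> exp (- \<alpha>0 * z) * (0 + energy_on Q0 W) + 0) at_top"
    by (intro tendsto_add tendsto_mult tendsto_const out)
  then have "((\<lambda>\<alpha>1. ?in \<alpha>1 + ?out \<alpha>1) \<longlongrightarrow> energy_on Q0 W * exp (- \<alpha>0 * z)) at_top"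
    by (simp add: exp_minus mult.assoc[symmetric] mult.commute[of "energy_on Q0 W"])
  moreover have "\<forall>\<^sub>F \<alpha>1 in at_top. ?in \<alpha>1 + ?out \<alpha>1 = energy_on (Qs \<alpha>1 z) UNIV"
    using ev by eventually_elim simp
  ultimately have "((\<lambda>\<alpha>1. energy_on (Qs \<alpha>1 z) UNIV) \<longlongrightarrow> energy_on Q0 W * exp (- \<alpha>0 * z)) at_top"
    by (rule Lim_transform_eventually)
  then show ?thesis using out unfolding W_def by blast
qed

end
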